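(* Let $X=(X_t)_{t\ge0}$ be a symmetric jump-paring Lévy process in $\mathbb{R}^d$ (see context), with Lévy density $\nu$ and transition densities $p(t,x)$. Suppose that all of the following hold: - there is a constant $C_9$ such that $\sup_{|x|\ge r}p(t,x)\le C_9\,t\,\Psi(1/r)\,r^{-d}$ for all $t>0$, $r\ge1$; - $\int_{\mathbb{R}^d}|x|^2\nu(dx)<\infty$; - there exist $C_{17}\ge1$ and $R_0>0$ such that $p(t,x)\le C_{17}\,p(t,y)$ for every $t>0$ and all $|x|\ge|y|\ge R_0$ with $|x-y|\le1$; - there exists $\kappa_1\ge2$ such that $\lim_{s\to\infty}K_1^X(\kappa_1s)\,K_2^X(s,\kappa_1s,\infty)=0$; - there exists $\kappa_2<\infty$ such that for all $s_1\ge1$, $\limsup_{s\to\infty}K_2^X(s_1,s,\infty)\le\kappa_2$. Then for every $\eta>0$ and $r>0$ there exist $C_{19}=C_{19}(X,\eta,r)$ and $R=R(X,\eta,r)>r$ such that $$\mathbf{E}^x\left[e^{-\eta\,\tau_{\overline B(0,r)^c}}\right]\le C_{19}\,\nu(x),\qquad|x|\ge R.$$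
   Context: Process. $X=(X_t)_{t\ge0}$ is a symmetric Lévy process with values in $\mathbb{R}^d$, $d\ge1$; $\mathbf{P}^x,\mathbf{E}^x$ are the law and expectation for the process started at $x$. It is determined by $\mathbf{E}^0[e^{i\xi\cdot X_t}]=e^{-t\psi(\xi)}$ with $\psi(\xi)=A\xi\cdot\xi+\int(1-\cos(\xi\cdot z))\,\nu(dz)$, where $A$ is a symmetric non-negative definite matrix and $\nu$ is a symmetric Lévy measure. Standing assumption: $\nu(\mathbb{R}^d\setminus\{0\})=\infty$ and $\nu(dx)=\nu(x)dx$ with $\nu(x)>0$ (the density is also denoted $\nu$). Then $X_t$ has transition densities $p(t,x)$, $\mathbf{P}^0(X_t\in E)=\int_Ep(t,x)dx$. $\Psi(r)=\sup_{|\xi|\le r}\psi(\xi)$, $r>0$. $B(x,r)$ is the open ball, $\overline B(x,r)$ the closed ball. $\tau_D=\inf\{t\ge0:X_t\notin D\}$; in particular $\tau_{\overline B(0,r)^c}$ is the first hitting time of $\overline B(0,r)$, and $e^{-\eta\cdot\infty}=0$. For bounded open $D$ and $x,y\in D$, $p_D(t,x,y)=p(t,y-x)-\mathbf{E}^x[\tau_D<t;\,p(t-\tau_D,y-X_{\tau_D})]$ and $G_D(x,y)=\int_0^\infty p_D(t,x,y)dt$; $G_D(x,y)=0$ if $x\notin D$ or $y\notin D$. $X$ is a symmetric jump-paring Lévy process if: (i) there are a non-increasing $g:(0,\infty)\to(0,\infty)$ and a constant $C_5\ge1$ with $C_5^{-1}g(|x|)\le\nu(x)\le C_5g(|x|)$,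 $x\neq0$; there is $C_6$ with $g(|x|)\le C_6g(|x|+1)$ for $|x|\ge1$; there is $C_7$ with $\int_{|x-y|>1,|y|>1}g(|x-y|)g(|y|)dy\le C_7g(|x|)$ for $|x|\ge1$; (ii) there is $t_{\rm b}>0$ with $\sup_xp(t_{\rm b},x)=p(t_{\rm b},0)<\infty$; (iii) for all $0<p<q<r<\infty$, $\sup_{x\in B(0,p)}\sup_{y\in B(0,q)^c}G_{B(0,r)}(x,y)<\infty$. Parameter functions. For $s\ge1$, $K_1^X(s)=\sup_{|x|\ge s}\frac{1}{\nu(x)}\int_{|x-y|>s,|y|>s}\nu(x-y)\nu(y)dy$. For $0<s_1<s_2<s_3\le\infty$, $K_2^X(s_1,s_2,s_3)=\inf\{C\ge1:\nu(x-y)\le C\nu(x)\text{ for all }|y|\le s_1,\ s_2\le|x|<s_3\}$. *)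

theory Defs
  imports "HOL-Probability.Probability"
begin

text \<open>
  A process started at \<open>x\<close> under the law \<open>P\<^sup>x\<close> is realised as \<open>x + X\<close>, where \<open>X\<close> is a Levy
  process started at the origin on a fixed probability space \<open>M\<close>.
\<close>

definition cadlag :: "(real \<Rightarrow> 'a::topological_space) \<Rightarrow> bool" where
  "cadlag f \<longleftrightarrow>
     (\<forall>t\<ge>0. (f \<longlongrightarrow> f t) (at_right t)) \<and>
     (\<forall>t>0. \<exists>l. (f \<longlongrightarrow> l) (at_left t))"

definition levy_process :: "'w measure \<Rightarrow> (real \<Rightarrow> 'w \<Rightarrow> real^'d) \<Rightarrow> bool" where
  "levy_process M X \<longleftrightarrow>
     prob_space M \<and>
     (\<forall>t\<ge>0. X t \<in> borel_measurable M) \<and>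
     (AE w in M. X 0 w = 0) \<and>
     (\<forall>(n::nat) (t::nat \<Rightarrow> real). 0 \<le> t 0 \<and> (\<forall>i<n. t i \<le> t (Suc i)) \<longrightarrow>
        prob_space.indep_vars M (\<lambda>_. borel) (\<lambda>i w. X (t (Suc i)) w - X (t i) w) {..<n}) \<and>
     (\<forall>s t. 0 \<le> s \<and> s \<le> t \<longrightarrow>
        distr M borel (\<lambda>w. X t w - X s w) = distr M borel (X (t - s))) \<and>
     (AE w in M. cadlag (\<lambda>t. X t w))"

definition levy_measure :: "(real^'d) measure \<Rightarrow> bool" where
  "levy_measure N \<longleftrightarrow>
     sets N = sets borel \<and> emeasure N {0} = 0 \<and>
     (\<integral>\<^sup>+z. ennreal (min 1 ((norm z)\<^sup>2)) \<partial>N) < \<infinity>"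

definition symmetric_measure :: "(real^'d) measure \<Rightarrow> bool" where
  "symmetric_measure N \<longleftrightarrow> distr N borel uminus = N"

definition char_exponent ::
    "real^'d^'d \<Rightarrow> (real^'d) measure \<Rightarrow> real^'d \<Rightarrow> real" where
  "char_exponent A N \<xi> = (A *v \<xi>) \<bullet> \<xi> + (\<integral>z. 1 - cos (\<xi> \<bullet> z) \<partial>N)"

definition max_exponent ::
    "real^'d^'d \<Rightarrow> (real^'d) measure \<Rightarrow> real \<Rightarrow> real" where
  "max_exponent A N r = (SUP \<xi>\<in>cball 0 r. char_exponent A N \<xi>)"

definition symmetric_levy_process ::
    "'w measure \<Rightarrow> (real \<Rightarrow> 'w \<Rightarrow> real^'d) \<Rightarrow> real^'d^'d \<Rightarrow> (real^'d) measure \<Rightarrow> bool" where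
  "symmetric_levy_process M X A N \<longleftrightarrow>
     levy_process M X \<and>
     transpose A = A \<and> (\<forall>\<xi>. 0 \<le> (A *v \<xi>) \<bullet> \<xi>) \<and>
     levy_measure N \<and> symmetric_measure N \<and>
     (\<forall>t\<ge>0. \<forall>\<xi>. (\<integral>w. iexp (\<xi> \<bullet> X t w) \<partial>M) =
        complex_of_real (exp (- t * char_exponent A N \<xi>)))"

text \<open>The Levy measure with density \<open>\<nu>\<close>; the value of \<open>\<nu>\<close> at the origin is immaterial.\<close>

definition levy_meas_of :: "(real^'d \<Rightarrow> real) \<Rightarrow> (real^'d) measure" where
  "levy_meas_of \<nu> = density lborel (\<lambda>z. ennreal (\<nu> z))"

definition infinite_positive_density :: "(real^'d \<Rightarrow> real) \<Rightarrow> bool" where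
  "infinite_positive_density \<nu> \<longleftrightarrow>
     \<nu> \<in> borel_measurable borel \<and> (\<forall>z. z \<noteq> 0 \<longrightarrow> 0 < \<nu> z) \<and>
     emeasure (levy_meas_of \<nu>) (UNIV - {0}) = \<infinity>"

text \<open>
  Transition densities take values in \<open>[0, \<infinity>]\<close>, since \<open>p t 0 = \<infinity>\<close> may occur for small \<open>t\<close>.
  Only \<open>t > 0\<close> matters; any jointly measurable version is allowed.
\<close>

definition transition_density ::
    "'w measure \<Rightarrow> (real \<Rightarrow> 'w \<Rightarrow> real^'d) \<Rightarrow> (real \<Rightarrow> real^'d \<Rightarrow> ennreal) \<Rightarrow> bool" where
  "transition_density M X p \<longleftrightarrow>
     case_prod p \<in> borel_measurable (restrict_space (borel \<Otimes>\<^sub>M borel) ({0<..} \<times> UNIV)) \<and>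
     (\<forall>t>0. distributed M lborel (X t) (p t))"

text \<open>
  First exit time from \<open>D\<close> of the process started at \<open>x\<close>; it is \<open>\<infinity>\<close> if the path never leaves \<open>D\<close>.
  Exit times from general sets are measurable only with respect to the completion of \<open>M\<close>,
  so expectations of functionals of exit times are taken over \<open>completion M\<close>.
\<close>

definition exit_time ::
    "(real \<Rightarrow> 'w \<Rightarrow> real^'d) \<Rightarrow> real^'d \<Rightarrow> (real^'d) set \<Rightarrow> 'w \<Rightarrow> ennreal" where
  "exit_time X x D w = (INF t\<in>{t. 0 \<le> t \<and> x + X t w \<notin> D}. ennreal t)"

definition exit_laplace ::
    "'w measure \<Rightarrow> (real \<Rightarrow> 'w \<Rightarrow> real^'d) \<Rightarrow> (real^'d) set \<Rightarrow> real \<Rightarrow> real^'d \<Rightarrow> ennreal" where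
  "exit_laplace M X D \<eta> x =
     (\<integral>\<^sup>+w. (if exit_time X x D w = \<infinity> then 0
            else ennreal (exp (- \<eta> * enn2real (exit_time X x D w)))) \<partial>completion M)"

text \<open>
  The subtraction below is truncated subtraction on \<open>ennreal\<close>. By the strong Markov property the
  subtrahend is at most \<open>p t (y - x)\<close> for almost every \<open>y\<close>, so the truncation has no effect there.
\<close>

definition killed_density ::
    "'w measure \<Rightarrow> (real \<Rightarrow> 'w \<Rightarrow> real^'d) \<Rightarrow> (real \<Rightarrow> real^'d \<Rightarrow> ennreal) \<Rightarrow> (real^'d) set \<Rightarrow>
     real \<Rightarrow> real^'d \<Rightarrow> real^'d \<Rightarrow> ennreal" where
  "killed_density M X p D t x y =
     p t (y - x) -
     (\<integral>\<^sup>+w. (let \<tau> = exit_time X x D w in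
             if \<tau> < ennreal t
             then p (t - enn2real \<tau>) (y - (x + X (enn2real \<tau>) w))
             else 0) \<partial>completion M)"

definition green_function ::
    "'w measure \<Rightarrow> (real \<Rightarrow> 'w \<Rightarrow> real^'d) \<Rightarrow> (real \<Rightarrow> real^'d \<Rightarrow> ennreal) \<Rightarrow> (real^'d) set \<Rightarrow>
     real^'d \<Rightarrow> real^'d \<Rightarrow> ennreal" where
  "green_function M X p D x y =
     (if x \<in> D \<and> y \<in> D then \<integral>\<^sup>+t\<in>{0<..}. killed_density M X p D t x y \<partial>lborel else 0)"

definition jump_paring_density :: "(real^'d \<Rightarrow> real) \<Rightarrow> bool" where
  "jump_paring_density \<nu> \<longleftrightarrow>
     (\<exists>(g::real \<Rightarrow> real) C5 C6 C7.
        (\<forall>s>0. 0 < g s) \<and> (\<forall>s t. 0 < s \<and> s \<le> t \<longrightarrow> g t \<le> g s) \<and>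
        1 \<le> C5 \<and>
        (\<forall>x. x \<noteq> 0 \<longrightarrow> inverse C5 * g (norm x) \<le> \<nu> x \<and> \<nu> x \<le> C5 * g (norm x)) \<and>
        (\<forall>x::real^'d. 1 \<le> norm x \<longrightarrow> g (norm x) \<le> C6 * g (norm x + 1)) \<and>
        (\<forall>x::real^'d. 1 \<le> norm x \<longrightarrow>
           (\<integral>\<^sup>+y\<in>{y. 1 < norm (x - y) \<and> 1 < norm y}. ennreal (g (norm (x - y)) * g (norm y)) \<partial>lborel)
             \<le> ennreal (C7 * g (norm x))))"

definition symmetric_jump_paring_levy_process ::
    "'w measure \<Rightarrow> (real \<Rightarrow> 'w \<Rightarrow> real^'d) \<Rightarrow> real^'d^'d \<Rightarrow> (real^'d \<Rightarrow> real) \<Rightarrow>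
     (real \<Rightarrow> real^'d \<Rightarrow> ennreal) \<Rightarrow> bool" where
  "symmetric_jump_paring_levy_process M X A \<nu> p \<longleftrightarrow>
     infinite_positive_density \<nu> \<and>
     symmetric_levy_process M X A (levy_meas_of \<nu>) \<and>
     transition_density M X p \<and>
     jump_paring_density \<nu> \<and>
     (\<exists>t\<^sub>b>0. (SUP x. p t\<^sub>b x) = p t\<^sub>b 0 \<and> p t\<^sub>b 0 < \<infinity>) \<and>
     (\<forall>a b r. 0 < a \<and> a < b \<and> b < r \<longrightarrow>
        (SUP x\<in>ball 0 a. SUP y\<in>- ball 0 b. green_function M X p (ball 0 r) x y) < \<infinity>)"

definition K1 :: "(real^'d \<Rightarrow> real) \<Rightarrow> real \<Rightarrow> ennreal" where
  "K1 \<nu> s =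
     (SUP x\<in>{x. s \<le> norm x}.
        ennreal (1 / \<nu> x) *
        (\<integral>\<^sup>+y\<in>{y. s < norm (x - y) \<and> s < norm y}. ennreal (\<nu> (x - y) * \<nu> y) \<partial>lborel))"

text \<open>The infimum is \<open>\<infinity>\<close> if no admissible constant exists.\<close>

definition K2 :: "(real^'d \<Rightarrow> real) \<Rightarrow> real \<Rightarrow> real \<Rightarrow> ennreal \<Rightarrow> ennreal" where
  "K2 \<nu> s1 s2 s3 =
     (INF C\<in>{C::real. 1 \<le> C \<and>
               (\<forall>x y. norm y \<le> s1 \<and> s2 \<le> norm x \<and> ennreal (norm x) < s3 \<longrightarrow>
                  \<nu> (x - y) \<le> C * \<nu> x)}. ennreal C)"

end

theory Submission
  imports Defs
begin

text \<open>
  Suppose \<open>h \<ge> 0\<close> satisfies \<open>E h(x + X\<^sub>t) \<le> exp (\<eta> t) h(x)\<close> for all \<open>x\<close> and \<open>t\<close>, is at least \<open>1\<close> near the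
  closed ball, and is at most a multiple of \<open>\<nu>\<close> away from the origin. Optional stopping along the
  time grids \<open>k / n\<close>, right continuity of the paths and Fatou's lemma then bound the Laplace transform
  of the hitting time by \<open>h(x)\<close>, without the strong Markov property in continuous time.

  Such an \<open>h\<close> is obtained by convolving \<open>F = min 1 (a \<nu>)\<close> with a Gaussian of width \<open>\<sigma>\<close>. The condition on
  \<open>K2\<close> bounds the variation of \<open>F\<close> at scale \<open>\<sigma>\<close> by a factor \<open>\<kappa>\<close> independent of \<open>\<sigma>\<close>, so \<open>h\<close> is comparable to \<open>F\<close>
  and its second differences are \<open>O(|z|\<^sup>2 / \<sigma>\<^sup>2) h\<close>. Hence the Gaussian part and the small jumps contribute little
  to \<open>L h\<close> for large \<open>\<sigma>\<close>; the jumps larger than \<open>s\<close> contribute little because \<open>K1(s)\<close> and the tail of \<open>\<nu>\<close>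
  are small and \<open>a\<close> is large. Altogether \<open>L h \<le> \<eta> h\<close>.

  Being a mixture of cosines, \<open>h\<close> can be integrated against the law of \<open>X\<^sub>t\<close> and acted on by \<open>L\<close> using the
  characteristic exponent alone.
\<close>

section \<open>Gaussian kernels\<close>

text \<open>Factoring out \<open>exp (- (norm u)\<^sup>2 / 2)\<close> leaves
  \<open>exp (- q)\<close> times twice a hyperbolic cosine of \<open>u \<bullet> z\<close>, minus 2,
  which is of second order in \<open>z\<close>. The price is a factor exponential in
  \<open>norm u\<close>, harmless against the Gaussian.\<close>

lemma gaussian_second_difference:
  fixes u z :: "'a::euclidean_space"
  assumes z: "norm z \<le> 1"
  shows "\<bar>exp (- (norm (u + z))\<^sup>2 / 2) + exp (- (norm (u - z))\<^sup>2 / 2) - 2 * exp (- (norm u)\<^sup>2 / 2)\<bar>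
    \<le> 2 * (norm z)\<^sup>2 * exp (- (norm u)\<^sup>2 / 2 + 2 * norm u)"
proof -
  define b q where "b = \<bar>u \<bullet> z\<bar>" and "q = (norm z)\<^sup>2 / 2"
  define k where "k = exp (- (norm u)\<^sup>2 / 2)"
  have bz: "b \<le> norm u * norm z"
    unfolding b_def by (rule Cauchy_Schwarz_ineq2)
  also have "\<dots> \<le> norm u" using z by (simp add: mult_left_le)
  finally have bu: "b \<le> norm u" .
  have b0: "0 \<le> b" by (simp add: b_def)
  have k0: "0 < k" by (simp add: k_def)
  have n1: "(norm (u + z))\<^sup>2 = (norm u)\<^sup>2 + 2 * (u \<bullet> z) + (norm z)\<^sup>2"
    and n2: "(norm (u - z))\<^sup>2 = (norm u)\<^sup>2 - 2 * (u \<bullet> z) + (norm z)\<^sup>2"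
    unfolding power2_norm_eq_inner by (simp_all add: algebra_simps inner_commute)
  have e1: "exp (- (norm (u + z))\<^sup>2 / 2) = k * exp (- q) * exp (- (u \<bullet> z))"
    "exp (- (norm (u - z))\<^sup>2 / 2) = k * exp (- q) * exp (u \<bullet> z)"
    by (simp_all add: n1 n2 k_def q_def flip: exp_add)
  have ee: "exp (- (u \<bullet> z)) + exp (u \<bullet> z) = exp b + exp (- b)"
    by (auto simp: b_def abs_if)
  have S: "exp (- (norm (u + z))\<^sup>2 / 2) + exp (- (norm (u - z))\<^sup>2 / 2) - 2 * exp (- (norm u)\<^sup>2 / 2)
     = k * (exp (- q) * (exp b + exp (- b)) - 2)"
    unfolding e1 ee[symmetric] k_def[symmetric] by (simp add: algebra_simps)
  \<comment> \<open>The perfect square turns the first-order estimate of \<open>exp b - 1\<close>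
    into a second-order one.\<close>
  have sq: "exp b + exp (- b) - 2 = exp (- b) * (exp b - 1)\<^sup>2"
    by (simp add: power2_eq_square algebra_simps exp_minus field_simps)
  have "1 - b \<le> exp (- b)" using exp_ge_add_one_self[of "-b"] by simp
  hence "(1 - b) * exp b \<le> exp (- b) * exp b" by (rule mult_right_mono) simp
  hence "exp b - 1 \<le> b * exp b" by (simp add: algebra_simps exp_minus)
  moreover have "0 \<le> exp b - 1" using b0 by simp
  ultimately have "(exp b - 1)\<^sup>2 \<le> (b * exp b)\<^sup>2" by (intro power_mono)
  hence "exp b + exp (- b) - 2 \<le> exp (- b) * (b * exp b)\<^sup>2"
    unfolding sq by (intro mult_left_mono) auto
  also have "\<dots> = b\<^sup>2 * exp b" by (simp add: power2_eq_square exp_minus field_simps)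
  also have "\<dots> \<le> ((norm u)\<^sup>2 * (norm z)\<^sup>2) * exp (norm u)"
    using power_mono[OF bz b0, of 2] bu by (intro mult_mono) (auto simp: power_mult_distrib)
  also have "\<dots> \<le> ((2 * exp (norm u)) * (norm z)\<^sup>2) * exp (norm u)"
  proof -
    have "(norm u)\<^sup>2 \<le> 2 * exp (norm u)"
      using exp_lower_Taylor_quadratic[of "norm u"] norm_ge_zero[of u] by linarith
    thus ?thesis by (intro mult_right_mono) auto
  qed
  also have "\<dots> = 2 * (norm z)\<^sup>2 * exp (2 * norm u)"
    by (simp add: mult_exp_exp)
  finally have up: "exp b + exp (- b) - 2 \<le> 2 * (norm z)\<^sup>2 * exp (2 * norm u)" .
  have two: "2 \<le> exp b + exp (- b)" using sq by (smt (verit) exp_ge_zero zero_le_mult_iff zero_le_power2)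
  have "exp (- q) * (exp b + exp (- b)) \<le> 1 * (exp b + exp (- b))"
    using two by (intro mult_right_mono) (auto simp: q_def)
  hence U: "exp (- q) * (exp b + exp (- b)) - 2 \<le> 2 * (norm z)\<^sup>2 * exp (2 * norm u)"
    using up by simp
  have "exp (- q) * 2 \<le> exp (- q) * (exp b + exp (- b))" using two by simp
  moreover have "1 - q \<le> exp (- q)" using exp_ge_add_one_self[of "-q"] by simp
  moreover have "2 * q = (norm z)\<^sup>2" by (simp add: q_def)
  ultimately have "- (norm z)\<^sup>2 \<le> exp (- q) * (exp b + exp (- b)) - 2" by linarith
  moreover have "(norm z)\<^sup>2 * 1 \<le> (norm z)\<^sup>2 * (2 * exp (2 * norm u))"
    by (intro mult_left_mono) (use one_le_exp_iff[of "2 * norm u"] in \<open>auto simp del: one_le_exp_iff, linarith?\<close>)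
  ultimately have "\<bar>exp (- q) * (exp b + exp (- b)) - 2\<bar> \<le> 2 * (norm z)\<^sup>2 * exp (2 * norm u)"
    using U by (simp add: abs_le_iff algebra_simps)
  hence "k * \<bar>exp (- q) * (exp b + exp (- b)) - 2\<bar> \<le> k * (2 * (norm z)\<^sup>2 * exp (2 * norm u))"
    using k0 by (intro mult_left_mono) auto
  moreover have "exp (- (norm u)\<^sup>2 / 2 + 2 * norm u) = k * exp (2 * norm u)"
    unfolding k_def exp_add ..
  ultimately show ?thesis unfolding S abs_mult using k0 by (simp add: mult_ac)
qed

text \<open>Since \<open>(norm u / 2 - c)\<^sup>2\<close> is nonnegative, the exponent is at most
  \<open>c\<^sup>2 - (norm u)\<^sup>2 / 4\<close>, and the resulting Gaussian factorizes over the
  coordinates.\<close>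

lemma nn_integral_gaussian_exp_finite:
  fixes c :: real
  shows "(\<integral>\<^sup>+u. ennreal (exp (- (norm (u::'a::euclidean_space))\<^sup>2 / 2 + c * norm u)) \<partial>lborel) < \<infinity>"
proof -
  have b: "- (norm u)\<^sup>2 / 2 + c * norm u \<le> c\<^sup>2 + (\<Sum>b\<in>Basis. - (u \<bullet> b)\<^sup>2 / 4)" for u :: 'a
  proof -
    have "(\<Sum>b\<in>Basis. - (u \<bullet> b)\<^sup>2 / 4) = - (norm u)\<^sup>2 / 4"
      by (simp add: norm_eq_sqrt_inner euclidean_inner[of u u] power2_eq_square sum_negf sum_divide_distrib
        sum_nonneg)
    moreover have "0 \<le> (norm u / 2 - c)\<^sup>2" by simp
    ultimately show ?thesis by (simp add: power2_eq_square algebra_simps)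
  qed
  have one: "(\<integral>\<^sup>+x. ennreal (exp (- x\<^sup>2 / 4)) \<partial>(lborel :: real measure)) < \<infinity>"
  proof -
    have "integrable lborel (\<lambda>x::real. sqrt (2 * pi * 2) * normal_density 0 (sqrt 2) x)"
      by (intro integrable_mult_right integrable_normal_density) auto
    also have "(\<lambda>x::real. sqrt (2 * pi * 2) * normal_density 0 (sqrt 2) x) = (\<lambda>x. exp (- x\<^sup>2 / 4))"
      by (auto simp: normal_density_def fun_eq_iff)
    finally show ?thesis by (simp add: integrable_iff_bounded)
  qed
  have "(\<integral>\<^sup>+u. ennreal (exp (- (norm (u::'a))\<^sup>2 / 2 + c * norm u)) \<partial>lborel)
    \<le> (\<integral>\<^sup>+u. ennreal (exp (c\<^sup>2)) * (\<Prod>b\<in>Basis. ennreal (exp (- (u \<bullet> b)\<^sup>2 / 4))) \<partial>(lborel::'a measure))"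
    using b by (intro nn_integral_mono)
      (auto simp: prod_ennreal simp flip: ennreal_mult exp_sum exp_add)
  also have "\<dots> = ennreal (exp (c\<^sup>2)) * (\<Prod>b\<in>(Basis::'a set). \<integral>\<^sup>+x. ennreal (exp (- x\<^sup>2 / 4)) \<partial>lborel)"
    by (subst nn_integral_cmult, simp, subst nn_integral_lborel_prod[where f="\<lambda>_ x. ennreal (exp (- x\<^sup>2 / 4))"]) simp_all
  also have "\<dots> < \<infinity>"
    using one by (auto simp: ennreal_mult_less_top power_less_top_ennreal)
  finally show ?thesis .
qed

text \<open>\<open>Z\<close> is a standard normal vector assembled from independent coordinates; the
  real part of its characteristic function exhibits the Gaussian kernel as an average of cosines.
  The second moment is what \<open>cosine_mixture\<close> asks of its frequencies.\<close>

lemma gaussian_cos_representation: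
  fixes G :: "('a::euclidean_space \<Rightarrow> real) measure" and Z :: "('a \<Rightarrow> real) \<Rightarrow> 'a"
  defines "G \<equiv> PiM Basis (\<lambda>_. std_normal_distribution)"
    and "Z \<equiv> \<lambda>w. \<Sum>b\<in>Basis. w b *\<^sub>R b"
  shows "prob_space G" "Z \<in> borel_measurable G" "integrable G (\<lambda>w. (norm (Z w))\<^sup>2)"
    "(\<integral>w. cos (Z w \<bullet> u) \<partial>G) = exp (- (norm u)\<^sup>2 / 2)"
proof -
  interpret N: prob_space std_normal_distribution by (rule prob_space_normal_density) simp
  interpret P: product_prob_space "\<lambda>_::'a. std_normal_distribution" Basis ..
  interpret P': finite_product_prob_space "\<lambda>_::'a. std_normal_distribution" Basis
    by standard simp
  have PG: "prob_space G" unfolding G_def by (rule prob_space_PiM) (rule N.prob_space_axioms)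
  then interpret G: prob_space G .
  show "prob_space G" by fact
  have [measurable]: "\<And>b. b \<in> Basis \<Longrightarrow> (\<lambda>w. w b) \<in> borel_measurable G"
    unfolding G_def using measurable_component_singleton[of _ Basis "\<lambda>_. std_normal_distribution"]
    by (simp cong: measurable_cong_sets)
  show Zm[measurable]: "Z \<in> borel_measurable G" unfolding Z_def by measurable
  have Zb: "Z w \<bullet> b = w b" if "b \<in> Basis" for w b
    using that by (simp add: Z_def inner_sum_left inner_Basis if_distrib cong: if_cong)
  have "(norm (Z w))\<^sup>2 = (\<Sum>b\<in>Basis. (w b)\<^sup>2)" for w
    by (subst power2_norm_eq_inner, subst euclidean_inner) (auto simp: Zb power2_eq_square)
  moreover have "integrable G (\<lambda>w. (w b)\<^sup>2)" if b: "b \<in> Basis" for b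
  proof -
    have "integrable G (\<lambda>w. \<Prod>i\<in>Basis. (if i = b then (w i)\<^sup>2 else 1))"
      unfolding G_def
      apply (rule P.product_integrable_prod[where f="\<lambda>i x. (if i = b then x\<^sup>2 else 1)"])
      subgoal by simp
      subgoal for i by (cases "i = b") (use integrable_std_normal_distribution_moment[of 2] in auto)
      done
    also have "(\<lambda>w. \<Prod>i\<in>Basis. (if i = b then (w i)\<^sup>2 else (1::real))) = (\<lambda>w. (w b)\<^sup>2)"
      using b by (simp add: prod.delta)
    finally show ?thesis .
  qed
  ultimately show "integrable G (\<lambda>w. (norm (Z w))\<^sup>2)" by simp
  have "(\<integral>w. iexp (Z w \<bullet> u) \<partial>G) = (\<integral>w. (\<Prod>b\<in>Basis. iexp ((u \<bullet> b) * w b)) \<partial>G)"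
    by (intro Bochner_Integration.integral_cong refl, subst euclidean_inner)
      (simp add: Zb exp_sum sum_distrib_left mult_ac)
  also have "\<dots> = (\<Prod>b\<in>Basis. char std_normal_distribution (u \<bullet> b))"
    unfolding G_def char_def
    apply (rule P.product_integral_prod[where f="\<lambda>b x. iexp ((u \<bullet> b) * x)"])
    apply simp
    by (rule N.integrable_const_bound[where B=1]) auto
  also have "\<dots> = complex_of_real (exp (\<Sum>b\<in>Basis. - (u \<bullet> b)\<^sup>2 / 2))"
    by (simp add: char_std_normal_distribution exp_sum)
  also have "(\<Sum>b\<in>Basis. - (u \<bullet> b)\<^sup>2 / 2) = - (norm u)\<^sup>2 / 2"
    by (simp add: norm_eq_sqrt_inner euclidean_inner[of u u] power2_eq_square sum_negf sum_divide_distrib sum_nonneg)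
  finally have E: "(\<integral>w. iexp (Z w \<bullet> u) \<partial>G) = complex_of_real (exp (- (norm u)\<^sup>2 / 2))" .
  have "integrable G (\<lambda>w. iexp (Z w \<bullet> u))"
    by (rule G.integrable_const_bound[where B=1]) auto
  hence "(\<integral>w. Re (iexp (Z w \<bullet> u)) \<partial>G) = Re (\<integral>w. iexp (Z w \<bullet> u) \<partial>G)"
    by (rule integral_Re)
  thus "(\<integral>w. cos (Z w \<bullet> u) \<partial>G) = exp (- (norm u)\<^sup>2 / 2)"
    unfolding E by (simp add: cis_conv_exp[symmetric])
qed

section \<open>Mixtures of cosines\<close>

lemma one_minus_cos_le:
  fixes y :: real
  shows "1 - cos y \<le> y\<^sup>2 / 2"
proof -
  have "1 - cos y = 2 * (sin (y / 2))\<^sup>2"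
    using cos_double_sin[of "y / 2"] by simp
  also have "\<dots> \<le> 2 * (y / 2)\<^sup>2"
    using abs_sin_x_le_abs_x[of "y / 2"] by (intro mult_left_mono) (auto simp flip: abs_le_square_iff)
  finally show ?thesis by (simp add: power2_eq_square)
qed

lemma integrable_pair_dominated:
  fixes f :: "'a \<times> 'b \<Rightarrow> real"
  assumes "sigma_finite_measure P" "sigma_finite_measure Q"
    and [measurable]: "f \<in> borel_measurable (P \<Otimes>\<^sub>M Q)"
    and a: "integrable P a" and b: "integrable Q b"
    and le: "\<And>x y. \<bar>f (x, y)\<bar> \<le> \<bar>a x\<bar> * \<bar>b y\<bar>"
  shows "integrable (P \<Otimes>\<^sub>M Q) f"
proof -
  interpret P: sigma_finite_measure P by fact
  interpret Q: sigma_finite_measure Q by fact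
  interpret pair_sigma_finite P Q ..
  note [measurable] = borel_measurable_integrable[OF a] borel_measurable_integrable[OF b]
  have "(\<integral>\<^sup>+z. ennreal (norm (f z)) \<partial>(P \<Otimes>\<^sub>M Q)) = (\<integral>\<^sup>+x. \<integral>\<^sup>+y. ennreal (norm (f (x, y))) \<partial>Q \<partial>P)"
    by (rule Q.nn_integral_fst[symmetric]) measurable
  also have "\<dots> \<le> (\<integral>\<^sup>+x. \<integral>\<^sup>+y. ennreal \<bar>a x\<bar> * ennreal \<bar>b y\<bar> \<partial>Q \<partial>P)"
    using le by (intro nn_integral_mono) (auto simp flip: ennreal_mult)
  also have "\<dots> = (\<integral>\<^sup>+x. ennreal \<bar>a x\<bar> \<partial>P) * (\<integral>\<^sup>+y. ennreal \<bar>b y\<bar> \<partial>Q)"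
    by (simp add: nn_integral_cmult nn_integral_multc)
  also have "\<dots> < \<infinity>"
    using a b by (simp add: integrable_iff_bounded ennreal_mult_less_top)
  finally show ?thesis by (simp add: integrable_iff_bounded)
qed

text \<open>\<open>Q\<close> mixes waves of frequency \<open>\<zeta>\<close> and phase
  \<open>\<phi>\<close>. The characteristic exponent grows at most quadratically when the jumps have
  a second moment, so square integrability of \<open>\<zeta>\<close> allows the generator to be
  applied under the integral.\<close>

locale cosine_mixture = finite_measure Q for Q :: "'q measure" +
  fixes \<zeta> :: "'q \<Rightarrow> real^'d" and \<phi> :: "'q \<Rightarrow> real"
  assumes meas_\<zeta>[measurable]: "\<zeta> \<in> borel_measurable Q"
    and meas_\<phi>[measurable]: "\<phi> \<in> borel_measurable Q"
    and square_integrable: "integrable Q (\<lambda>q. (norm (\<zeta> q))\<^sup>2)"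
begin

definition mix :: "real^'d \<Rightarrow> real" where
  "mix x = (\<integral>q. cos (\<zeta> q \<bullet> x - \<phi> q) \<partial>Q)"

lemma borel_measurable_mix[measurable]: "mix \<in> borel_measurable borel"
  unfolding mix_def[abs_def] by measurable

lemma integrable_cos: "integrable Q (\<lambda>q. cos (\<zeta> q \<bullet> x - \<phi> q))"
  by (rule integrable_const_bound[where B=1]) auto

lemma mix_bounded: "\<bar>mix x\<bar> \<le> measure Q (space Q)"
proof -
  have "\<bar>mix x\<bar> \<le> (\<integral>q. \<bar>cos (\<zeta> q \<bullet> x - \<phi> q)\<bar> \<partial>Q)"
    unfolding mix_def by (rule integral_abs_bound)
  also have "\<dots> \<le> (\<integral>q. 1 \<partial>Q)"
    using integrable_cos by (intro integral_mono) auto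
  finally show ?thesis by simp
qed

text \<open>This is minus half of the usual symmetric second difference. Integrated against a
  symmetric Levy measure it gives minus the jump part of the generator.\<close>

definition second_diff :: "real^'d \<Rightarrow> real^'d \<Rightarrow> real" where
  "second_diff x z = mix x - mix (x + z) / 2 - mix (x - z) / 2"

text \<open>On a single cosine, the second difference multiplies by the integrand of the jump part
  of the exponent. This links pointwise regularity of \<open>mix\<close> with integrals over
  frequencies.\<close>

lemma second_diff_eq:
  "second_diff x z = (\<integral>q. (1 - cos (\<zeta> q \<bullet> z)) * cos (\<zeta> q \<bullet> x - \<phi> q) \<partial>Q)"
proof -
  have "second_diff x z =
      (\<integral>q. cos (\<zeta> q \<bullet> x - \<phi> q) - cos (\<zeta> q \<bullet> (x + z) - \<phi> q) / 2 - cos (\<zeta> q \<bullet> (x - z) - \<phi> q) / 2 \<partial>Q)"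
    unfolding mix_def second_diff_def using integrable_cos
    by (subst Bochner_Integration.integral_diff) (auto intro!: Bochner_Integration.integrable_diff)
  also have "\<dots> = (\<integral>q. (1 - cos (\<zeta> q \<bullet> z)) * cos (\<zeta> q \<bullet> x - \<phi> q) \<partial>Q)"
  proof (intro Bochner_Integration.integral_cong refl)
    fix q
    have "cos a - cos (a + b) / 2 - cos (a - b) / 2 = (1 - cos b) * cos a" for a b :: real
      by (simp add: cos_add cos_diff field_simps)
    from this[of "\<zeta> q \<bullet> x - \<phi> q" "\<zeta> q \<bullet> z"]
    show "cos (\<zeta> q \<bullet> x - \<phi> q) - cos (\<zeta> q \<bullet> (x + z) - \<phi> q) / 2 - cos (\<zeta> q \<bullet> (x - z) - \<phi> q) / 2
        = (1 - cos (\<zeta> q \<bullet> z)) * cos (\<zeta> q \<bullet> x - \<phi> q)"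
      by (simp add: inner_add_right inner_diff_right algebra_simps)
  qed
  finally show ?thesis .
qed

lemma integrable_square_cos:
  "integrable Q (\<lambda>q. (\<zeta> q \<bullet> a)\<^sup>2 * cos (\<zeta> q \<bullet> x - \<phi> q))"
proof (rule Bochner_Integration.integrable_bound)
  show "integrable Q (\<lambda>q. (norm (\<zeta> q))\<^sup>2 * (norm a)\<^sup>2)"
    by (intro integrable_mult_left square_integrable)
  have "\<bar>\<zeta> q \<bullet> a\<bar>\<^sup>2 * \<bar>cos (\<zeta> q \<bullet> x - \<phi> q)\<bar> \<le> (norm (\<zeta> q) * norm a)\<^sup>2 * 1" for q
    by (intro mult_mono power_mono Cauchy_Schwarz_ineq2) auto
  thus "AE q in Q. norm ((\<zeta> q \<bullet> a)\<^sup>2 * cos (\<zeta> q \<bullet> x - \<phi> q)) \<le> norm ((norm (\<zeta> q))\<^sup>2 * (norm a)\<^sup>2)"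
    by (auto simp: abs_mult power_mult_distrib)
qed measurable

text \<open>The integral is minus a directional second derivative of \<open>mix\<close>, a limit of second differences.\<close>

lemma quadratic_bound:
  assumes s: "0 < s" and c: "\<And>z. norm z \<le> s \<Longrightarrow> \<bar>second_diff x z\<bar> \<le> c * (norm z)\<^sup>2"
  shows "\<bar>\<integral>q. (\<zeta> q \<bullet> a)\<^sup>2 * cos (\<zeta> q \<bullet> x - \<phi> q) \<partial>Q\<bar> \<le> 2 * c * (norm a)\<^sup>2"
proof -
  define m where "m n = real n + 1" for n
  have m: "m n > 0" for n by (simp add: m_def)
  \<comment> \<open>A second difference in direction \<open>a\<close> at scale
    \<open>1 / m n\<close>, rescaled because \<open>1 - cos y\<close> behaves like
    \<open>y\<^sup>2 / 2\<close> near 0.\<close>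
  define f where "f n q = 2 * (m n)\<^sup>2 * ((1 - cos (\<zeta> q \<bullet> (a /\<^sub>R m n))) * cos (\<zeta> q \<bullet> x - \<phi> q))" for n q
  have If: "integral\<^sup>L Q (f n) = 2 * (m n)\<^sup>2 * second_diff x (a /\<^sub>R m n)" for n
    unfolding f_def second_diff_eq by (rule integral_mult_right_zero)
  have lim: "(\<lambda>n. integral\<^sup>L Q (f n)) \<longlonglongrightarrow> (\<integral>q. (\<zeta> q \<bullet> a)\<^sup>2 * cos (\<zeta> q \<bullet> x - \<phi> q) \<partial>Q)"
  proof (rule integral_dominated_convergence)
    show "integrable Q (\<lambda>q. (norm (\<zeta> q))\<^sup>2 * (norm a)\<^sup>2)"
      by (intro integrable_mult_left square_integrable)
    show "f n \<in> borel_measurable Q" for n unfolding f_def by measurable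
    show "(\<lambda>q. (\<zeta> q \<bullet> a)\<^sup>2 * cos (\<zeta> q \<bullet> x - \<phi> q)) \<in> borel_measurable Q" by measurable
    have "(\<lambda>n. 2 * (m n)\<^sup>2 * (1 - cos (v / m n))) \<longlonglongrightarrow> v\<^sup>2" for v
    proof -
      have "(\<lambda>n. v / m n) \<longlonglongrightarrow> 0" unfolding m_def
        by (intro real_tendsto_divide_at_top[OF tendsto_const]
          filterlim_at_top_mono[OF filterlim_real_sequentially]) auto
      hence h: "(\<lambda>n. v / m n / 2) \<longlonglongrightarrow> 0"
        using tendsto_divide[OF _ tendsto_const[of 2]] by fastforce
      \<comment> \<open>\<open>1 - cos\<close> is expressed through the square of
        \<open>sin y / y\<close>; the value 1 at 0 makes this quotient continuous there.\<close>
      have sinc: "isCont (\<lambda>y. if y = 0 then 1 else sin y / y) (0::real)"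
        using sinc_at_0 by (simp add: isCont_def cong: LIM_cong)
      have "(\<lambda>n. (\<lambda>y. if y = 0 then 1 else sin y / y) (v / m n / 2)) \<longlonglongrightarrow> 1"
        using isCont_tendsto_compose[OF sinc h] by simp
      hence "(\<lambda>n. v\<^sup>2 * ((\<lambda>y. if y = 0 then 1 else sin y / y) (v / m n / 2))\<^sup>2) \<longlonglongrightarrow> v\<^sup>2 * 1\<^sup>2"
        by (intro tendsto_intros)
      moreover have "v\<^sup>2 * ((\<lambda>y. if y = 0 then 1 else sin y / y) (v / m n / 2))\<^sup>2
          = 2 * (m n)\<^sup>2 * (1 - cos (v / m n))" for n
      proof -
        have c: "1 - cos (v / m n) = 2 * (sin (v / m n / 2))\<^sup>2"
          using cos_double_sin[of "v / m n / 2"] by simp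
        show ?thesis unfolding c using m[of n] by (cases "v = 0") (simp_all add: power_divide power_mult_distrib)
      qed
      ultimately show ?thesis by simp
    qed
    hence "(\<lambda>n. 2 * (m n)\<^sup>2 * (1 - cos (\<zeta> q \<bullet> a / m n)) * cos (\<zeta> q \<bullet> x - \<phi> q))
        \<longlonglongrightarrow> (\<zeta> q \<bullet> a)\<^sup>2 * cos (\<zeta> q \<bullet> x - \<phi> q)" for q
      by (intro tendsto_mult[OF _ tendsto_const])
    hence "(\<lambda>n. f n q) \<longlonglongrightarrow> (\<zeta> q \<bullet> a)\<^sup>2 * cos (\<zeta> q \<bullet> x - \<phi> q)" for q
      by (simp add: f_def divide_inverse mult_ac)
    thus "AE q in Q. (\<lambda>n. f n q) \<longlonglongrightarrow> (\<zeta> q \<bullet> a)\<^sup>2 * cos (\<zeta> q \<bullet> x - \<phi> q)" by simp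
    have "norm (f n q) \<le> (norm (\<zeta> q))\<^sup>2 * (norm a)\<^sup>2" for n q
    proof -
      have "norm (f n q) = 2 * (m n)\<^sup>2 * (1 - cos (\<zeta> q \<bullet> (a /\<^sub>R m n))) * \<bar>cos (\<zeta> q \<bullet> x - \<phi> q)\<bar>"
        by (simp add: f_def abs_mult)
      also have "\<dots> \<le> 2 * (m n)\<^sup>2 * ((\<zeta> q \<bullet> (a /\<^sub>R m n))\<^sup>2 / 2) * 1"
        by (intro mult_mono one_minus_cos_le) auto
      also have "\<dots> = (\<zeta> q \<bullet> a)\<^sup>2" using m[of n] by (simp add: power2_eq_square field_simps)
      also have "\<dots> \<le> (norm (\<zeta> q) * norm a)\<^sup>2"
        using Cauchy_Schwarz_ineq2[of "\<zeta> q" a] by (simp flip: abs_le_square_iff)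
      finally show ?thesis by (simp add: power_mult_distrib)
    qed
    thus "\<And>n. AE q in Q. norm (f n q) \<le> (norm (\<zeta> q))\<^sup>2 * (norm a)\<^sup>2" by simp
  qed
  \<comment> \<open>From \<open>n0\<close> on, the displacement \<open>a /\<^sub>R m n\<close> stays
    in the ball of radius \<open>s\<close>, where \<open>c\<close> applies.\<close>
  obtain n0 where n0: "norm a / s \<le> real n0" using real_arch_simple by blast
  have "\<bar>integral\<^sup>L Q (f n)\<bar> \<le> 2 * c * (norm a)\<^sup>2" if "n \<ge> n0" for n
  proof -
    have "norm a / s \<le> m n" using n0 that by (simp add: m_def)
    hence "norm (a /\<^sub>R m n) \<le> s" using s m[of n] by (simp add: field_simps)
    from c[OF this] have "2 * (m n)\<^sup>2 * \<bar>second_diff x (a /\<^sub>R m n)\<bar> \<le> 2 * (m n)\<^sup>2 * (c * (norm (a /\<^sub>R m n))\<^sup>2)"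
      by (intro mult_left_mono) auto
    thus ?thesis unfolding If using m[of n] by (simp add: abs_mult field_simps power2_eq_square)
  qed
  thus ?thesis
    by (intro LIMSEQ_le_const2[OF tendsto_rabs[OF lim]]) auto
qed

text \<open>Polarization writes a product of two coordinates of \<open>\<zeta> q\<close> as a
  quarter of a difference of squares along the sum and the difference of two axes. Both directions
  have squared norm at most 4, so \<open>quadratic_bound\<close> gives
  \<open>(8 c + 8 c) / 4 = 4 c\<close> per matrix entry.\<close>

lemma quadratic_form_bound:
  fixes A :: "real^'d^'d"
  assumes s: "0 < s" and c: "\<And>z. norm z \<le> s \<Longrightarrow> \<bar>second_diff x z\<bar> \<le> c * (norm z)\<^sup>2"
  shows "integrable Q (\<lambda>q. ((A *v \<zeta> q) \<bullet> \<zeta> q) * cos (\<zeta> q \<bullet> x - \<phi> q))"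
    "\<bar>\<integral>q. ((A *v \<zeta> q) \<bullet> \<zeta> q) * cos (\<zeta> q \<bullet> x - \<phi> q) \<partial>Q\<bar> \<le> 4 * c * (\<Sum>i\<in>UNIV. \<Sum>j\<in>UNIV. \<bar>A $ i $ j\<bar>)"
proof -
  let ?e = "\<lambda>i. axis i 1 :: real^'d"
  let ?g = "\<lambda>a q. (\<zeta> q \<bullet> a)\<^sup>2 * cos (\<zeta> q \<bullet> x - \<phi> q)"
  let ?t = "\<lambda>i j q. (?g (?e i + ?e j) q - ?g (?e i - ?e j) q) / 4"
  have comp: "\<zeta> q $ i = \<zeta> q \<bullet> ?e i" for q i by (simp add: inner_axis)
  have "\<zeta> q $ i * \<zeta> q $ j * cos (\<zeta> q \<bullet> x - \<phi> q) = ?t i j q" for q i j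
    unfolding comp inner_add_right inner_diff_right by (simp add: power2_eq_square algebra_simps)
  note polarization = this
  have exp: "((A *v \<zeta> q) \<bullet> \<zeta> q) * cos (\<zeta> q \<bullet> x - \<phi> q) = (\<Sum>i\<in>UNIV. \<Sum>j\<in>UNIV. A $ i $ j * ?t i j q)" for q
  proof -
    have "(A *v v) \<bullet> v = (\<Sum>i\<in>UNIV. \<Sum>j\<in>UNIV. A $ i $ j * (v $ i * v $ j))" for v
      by (simp add: inner_vec_def matrix_vector_mult_def sum_distrib_right sum_distrib_left mult_ac)
    hence "((A *v \<zeta> q) \<bullet> \<zeta> q) * cos (\<zeta> q \<bullet> x - \<phi> q)
        = (\<Sum>i\<in>UNIV. \<Sum>j\<in>UNIV. A $ i $ j * (\<zeta> q $ i * \<zeta> q $ j * cos (\<zeta> q \<bullet> x - \<phi> q)))"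
      by (simp add: sum_distrib_right mult.assoc)
    thus ?thesis unfolding polarization .
  qed
  have int: "integrable Q (?t i j)" for i j
    using integrable_square_cos by auto
  show "integrable Q (\<lambda>q. ((A *v \<zeta> q) \<bullet> \<zeta> q) * cos (\<zeta> q \<bullet> x - \<phi> q))"
    unfolding exp using int by (intro Bochner_Integration.integrable_sum integrable_mult_right)
  \<comment> \<open>Evaluating the hypothesis at one vector of norm \<open>s\<close> forces the sign
    of \<open>c\<close>; \<open>undefined\<close> merely names some coordinate.\<close>
  have c0: "0 \<le> c"
  proof -
    have "norm (s *\<^sub>R ?e undefined) = s" using s by simp
    moreover from this have "0 \<le> c * (norm (s *\<^sub>R ?e undefined))\<^sup>2"
      by (intro order_trans[OF abs_ge_zero c]) simp
    ultimately have "0 \<le> c * s\<^sup>2" by (simp only:)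
    thus ?thesis using s by (simp add: zero_le_mult_iff)
  qed
  have n2: "(norm (?e i + ?e j))\<^sup>2 \<le> 4" "(norm (?e i - ?e j))\<^sup>2 \<le> 4" for i j
    using power_mono[OF norm_triangle_ineq[of "?e i" "?e j"], of 2]
      power_mono[OF norm_triangle_ineq4[of "?e i" "?e j"], of 2] by auto
  have b: "\<bar>integral\<^sup>L Q (?t i j)\<bar> \<le> 4 * c" for i j
  proof -
    have "\<bar>integral\<^sup>L Q (?g (?e i + ?e j))\<bar> \<le> 2 * c * 4" "\<bar>integral\<^sup>L Q (?g (?e i - ?e j))\<bar> \<le> 2 * c * 4"
      using quadratic_bound[OF s c, of "?e i + ?e j"] quadratic_bound[OF s c, of "?e i - ?e j"]
        mult_left_mono[OF n2(1)[of i j], of "2 * c"] mult_left_mono[OF n2(2)[of i j], of "2 * c"] c0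
      by auto
    moreover have "integral\<^sup>L Q (?t i j) = (integral\<^sup>L Q (?g (?e i + ?e j)) - integral\<^sup>L Q (?g (?e i - ?e j))) / 4"
      using integrable_square_cos by (simp add: Bochner_Integration.integral_diff)
    moreover have "\<bar>(p - r) / 4\<bar> \<le> 4 * c" if "\<bar>p\<bar> \<le> 2 * c * 4" "\<bar>r\<bar> \<le> 2 * c * 4" for p r
      using abs_triangle_ineq4[of p r] that by simp
    ultimately show ?thesis by (simp only:)
  qed
  have "(\<integral>q. ((A *v \<zeta> q) \<bullet> \<zeta> q) * cos (\<zeta> q \<bullet> x - \<phi> q) \<partial>Q)
     = (\<Sum>i\<in>UNIV. \<Sum>j\<in>UNIV. A $ i $ j * integral\<^sup>L Q (?t i j))"
    unfolding exp using int
    by (subst Bochner_Integration.integral_sum, (intro Bochner_Integration.integrable_sum integrable_mult_right; simp))+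
      (intro sum.cong refl integral_mult_right_zero)
  also have "\<bar>\<dots>\<bar> \<le> (\<Sum>i\<in>UNIV. \<Sum>j\<in>UNIV. \<bar>A $ i $ j\<bar> * (4 * c))"
    by (intro order_trans[OF sum_abs] sum_mono) (unfold abs_mult, intro mult_left_mono b abs_ge_zero)
  also have "\<dots> = 4 * c * (\<Sum>i\<in>UNIV. \<Sum>j\<in>UNIV. \<bar>A $ i $ j\<bar>)"
    by (simp add: sum_distrib_left mult_ac)
  finally show "\<bar>\<integral>q. ((A *v \<zeta> q) \<bullet> \<zeta> q) * cos (\<zeta> q \<bullet> x - \<phi> q) \<partial>Q\<bar> \<le> 4 * c * (\<Sum>i\<in>UNIV. \<Sum>j\<in>UNIV. \<bar>A $ i $ j\<bar>)" .
qed

end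

section \<open>The jump part and the full characteristic exponent, integrated over
  frequencies\<close>

context cosine_mixture
begin

text \<open>Fubini's theorem combined with \<open>second_diff_eq\<close>: the bound on
  \<open>1 - cos\<close> gives a majorant that is a product of two squared norms, one integrable
  over \<open>Q\<close>, the other over \<open>N\<close>.\<close>

lemma jump_integral:
  fixes N :: "(real^'d) measure"
  assumes N: "sigma_finite_measure N" and [measurable_cong]: "sets N = sets borel"
    and N2: "integrable N (\<lambda>z. (norm z)\<^sup>2)"
  shows "integrable Q (\<lambda>q. (\<integral>z. 1 - cos (\<zeta> q \<bullet> z) \<partial>N) * cos (\<zeta> q \<bullet> x - \<phi> q))"
    and "integrable N (second_diff x)"
    and "(\<integral>q. (\<integral>z. 1 - cos (\<zeta> q \<bullet> z) \<partial>N) * cos (\<zeta> q \<bullet> x - \<phi> q) \<partial>Q) = (\<integral>z. second_diff x z \<partial>N)"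
proof -
  interpret N: sigma_finite_measure N by fact
  interpret P: pair_sigma_finite Q N ..
  interpret P': pair_sigma_finite N Q ..
  let ?f = "\<lambda>(q, z). (1 - cos (\<zeta> q \<bullet> z)) * cos (\<zeta> q \<bullet> x - \<phi> q)"
  have int: "integrable (Q \<Otimes>\<^sub>M N) ?f"
  proof (rule integrable_pair_dominated[where a="\<lambda>q. (norm (\<zeta> q))\<^sup>2" and b="\<lambda>z. (norm z)\<^sup>2"])
    show "sigma_finite_measure Q" ..
    show "sigma_finite_measure N" ..
    show "?f \<in> borel_measurable (Q \<Otimes>\<^sub>M N)" by measurable
    show "\<bar>?f (q, z)\<bar> \<le> \<bar>(norm (\<zeta> q))\<^sup>2\<bar> * \<bar>(norm z)\<^sup>2\<bar>" for q z
    proof -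
      have "\<bar>?f (q, z)\<bar> = (1 - cos (\<zeta> q \<bullet> z)) * \<bar>cos (\<zeta> q \<bullet> x - \<phi> q)\<bar>" by (simp add: abs_mult)
      also have "\<dots> \<le> (\<zeta> q \<bullet> z)\<^sup>2 / 2 * 1" by (intro mult_mono one_minus_cos_le) auto
      also have "\<dots> \<le> (\<zeta> q \<bullet> z)\<^sup>2" by simp
      also have "\<dots> \<le> (norm (\<zeta> q) * norm z)\<^sup>2"
        using Cauchy_Schwarz_ineq2[of "\<zeta> q" z] by (simp flip: abs_le_square_iff)
      finally show ?thesis by (simp add: power_mult_distrib)
    qed
  qed (use square_integrable N2 in auto)
  from P.integrable_fst'[OF int]
  show "integrable Q (\<lambda>q. (\<integral>z. 1 - cos (\<zeta> q \<bullet> z) \<partial>N) * cos (\<zeta> q \<bullet> x - \<phi> q))" by simp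
  have "integrable N (\<lambda>z. \<integral>q. ?f (q, z) \<partial>Q)"
    using P.integrable_snd[of "\<lambda>q z. ?f (q, z)"] int by simp
  thus "integrable N (second_diff x)"
    by (simp add: second_diff_eq[abs_def] cong: Bochner_Integration.integrable_cong)
  have "(\<integral>z. \<integral>q. ?f (q, z) \<partial>Q \<partial>N) = (\<integral>q. \<integral>z. ?f (q, z) \<partial>N \<partial>Q)"
    using P.Fubini_integral[of "\<lambda>q z. ?f (q, z)"] int by simp
  thus "(\<integral>q. (\<integral>z. 1 - cos (\<zeta> q \<bullet> z) \<partial>N) * cos (\<zeta> q \<bullet> x - \<phi> q) \<partial>Q) = (\<integral>z. second_diff x z \<partial>N)"
    by (simp add: second_diff_eq)
qed

text \<open>Jumps up to size \<open>s\<close> cost at most \<open>c * (norm z)\<^sup>2\<close>. For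
  larger ones the nonnegative term \<open>mix x\<close> is dropped; by symmetry of \<open>N\<close>
  the two remaining halves have the same integral, at most \<open>T / 2\<close> each.\<close>

lemma jump_integral_lower:
  fixes N :: "(real^'d) measure"
  assumes N: "sigma_finite_measure N" and sets[measurable_cong]: "sets N = sets borel"
    and N2: "integrable N (\<lambda>z. (norm z)\<^sup>2)" and sym: "symmetric_measure N"
    and nonneg: "\<And>x. 0 \<le> mix x"
    and c0: "0 \<le> c" and c: "\<And>z. norm z \<le> s \<Longrightarrow> \<bar>second_diff x z\<bar> \<le> c * (norm z)\<^sup>2"
    and T: "(\<integral>\<^sup>+z\<in>{z. s < norm z}. ennreal (mix (x - z)) \<partial>N) \<le> ennreal T" and T0: "0 \<le> T"
  shows "- (c * (\<integral>z. (norm z)\<^sup>2 \<partial>N) + T) \<le> (\<integral>z. second_diff x z \<partial>N)"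
proof -
  let ?I = "indicator {z. s < norm z} :: _ \<Rightarrow> real"
  have I: "(\<integral>\<^sup>+z. ennreal (mix (x - z) * ?I z) \<partial>N) \<le> ennreal T"
  proof -
    have "ennreal (mix (x - z) * ?I z) = ennreal (mix (x - z)) * indicator {z. s < norm z} z" for z
      by (simp add: indicator_def)
    thus ?thesis using T by simp
  qed
  have "(\<integral>\<^sup>+z. ennreal (mix (x + z) * ?I z) \<partial>N) = (\<integral>\<^sup>+z. ennreal (mix (x + z) * ?I z) \<partial>distr N borel uminus)"
    using sym by (simp add: symmetric_measure_def)
  also have "\<dots> = (\<integral>\<^sup>+z. ennreal (mix (x - z) * ?I z) \<partial>N)"
    by (subst nn_integral_distr) (auto simp: indicator_def)
  finally have I': "(\<integral>\<^sup>+z. ennreal (mix (x + z) * ?I z) \<partial>N) \<le> ennreal T" using I by simp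
  have i1: "integrable N (\<lambda>z. mix (x - z) * ?I z)" and i2: "integrable N (\<lambda>z. mix (x + z) * ?I z)"
    using I I' nonneg
    by (auto intro!: integrableI_nonneg AE_I2 elim: order_le_less_trans simp: ennreal_less_top)
  have v1: "(\<integral>z. mix (x - z) * ?I z \<partial>N) \<le> T" and v2: "(\<integral>z. mix (x + z) * ?I z \<partial>N) \<le> T"
    using I I' nonneg T0 i1 i2 by (simp_all add: nn_integral_eq_integral AE_I2)
  have "- (c * (\<integral>z. (norm z)\<^sup>2 \<partial>N) + T)
      \<le> - c * (\<integral>z. (norm z)\<^sup>2 \<partial>N) - (\<integral>z. mix (x + z) * ?I z \<partial>N) / 2 - (\<integral>z. mix (x - z) * ?I z \<partial>N) / 2"
    using v1 v2 by simp
  also have "\<dots> = (\<integral>z. - c * (norm z)\<^sup>2 - mix (x + z) * ?I z / 2 - mix (x - z) * ?I z / 2 \<partial>N)"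
    using i1 i2 N2 by simp
  also have "\<dots> \<le> (\<integral>z. second_diff x z \<partial>N)"
  proof (rule integral_mono)
    show "integrable N (\<lambda>z. - c * (norm z)\<^sup>2 - mix (x + z) * ?I z / 2 - mix (x - z) * ?I z / 2)"
      using i1 i2 N2 by auto
    show "integrable N (second_diff x)" by (rule jump_integral(2)[OF N sets N2])
    fix z
    show "- c * (norm z)\<^sup>2 - mix (x + z) * ?I z / 2 - mix (x - z) * ?I z / 2 \<le> second_diff x z"
    proof (cases "s < norm z")
      case True
      have "0 \<le> c * (norm z)\<^sup>2" using c0 by simp
      thus ?thesis using True nonneg[of x] by (simp add: second_diff_def)
    next
      case False
      thus ?thesis using c[of z] by simp
    qed
  qed
  finally show ?thesis .
qed

text \<open>The matrix norm bound and the second moment of \<open>N\<close> dominate the exponent by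
  a multiple of \<open>(norm \<xi>)\<^sup>2\<close>.\<close>

lemma integrable_exponent:
  fixes N :: "(real^'d) measure" and A :: "real^'d^'d"
  assumes N: "sigma_finite_measure N" and sets[measurable_cong]: "sets N = sets borel"
    and N2: "integrable N (\<lambda>z. (norm z)\<^sup>2)"
  shows "char_exponent A N \<in> borel_measurable borel" "integrable Q (\<lambda>q. char_exponent A N (\<zeta> q))"
proof -
  interpret N: sigma_finite_measure N by fact
  show [measurable]: "char_exponent A N \<in> borel_measurable borel"
  proof -
    have [measurable]: "(*v) A \<in> borel_measurable borel"
      by (intro borel_measurable_continuous_onI linear_continuous_on matrix_vector_mul_bounded_linear)
    have [measurable]: "(\<lambda>\<xi>. \<integral>z. 1 - cos (\<xi> \<bullet> z) \<partial>N) \<in> borel_measurable borel"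
      by (rule N.borel_measurable_lebesgue_integral) measurable
    show ?thesis unfolding char_exponent_def[abs_def] by measurable
  qed
  obtain B where B: "\<And>x. norm (A *v x) \<le> norm x * B"
    using bounded_linear.bounded[OF matrix_vector_mul_bounded_linear[of A]] by blast
  define m where "m = (\<integral>z. (norm z)\<^sup>2 \<partial>N)"
  have "\<bar>char_exponent A N \<xi>\<bar> \<le> (B + m) * (norm \<xi>)\<^sup>2" for \<xi>
  proof -
    have "\<bar>(A *v \<xi>) \<bullet> \<xi>\<bar> \<le> norm (A *v \<xi>) * norm \<xi>" by (rule Cauchy_Schwarz_ineq2)
    also have "\<dots> \<le> norm \<xi> * B * norm \<xi>" using B by (intro mult_right_mono) auto
    finally have 1: "\<bar>(A *v \<xi>) \<bullet> \<xi>\<bar> \<le> B * (norm \<xi>)\<^sup>2" by (simp add: power2_eq_square mult_ac)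
    have le: "1 - cos (\<xi> \<bullet> z) \<le> (norm \<xi>)\<^sup>2 * (norm z)\<^sup>2" for z
    proof -
      have "1 - cos (\<xi> \<bullet> z) \<le> (\<xi> \<bullet> z)\<^sup>2 / 2" by (rule one_minus_cos_le)
      also have "\<dots> \<le> (\<xi> \<bullet> z)\<^sup>2" by simp
      also have "\<dots> \<le> (norm \<xi> * norm z)\<^sup>2"
        using Cauchy_Schwarz_ineq2[of \<xi> z] by (simp flip: abs_le_square_iff)
      finally show ?thesis by (simp add: power_mult_distrib)
    qed
    have "integrable N (\<lambda>z. 1 - cos (\<xi> \<bullet> z))"
      by (rule Bochner_Integration.integrable_bound[where f="\<lambda>z. (norm \<xi>)\<^sup>2 * (norm z)\<^sup>2"])
        (use N2 le in auto)
    hence "(\<integral>z. 1 - cos (\<xi> \<bullet> z) \<partial>N) \<le> (\<integral>z. (norm \<xi>)\<^sup>2 * (norm z)\<^sup>2 \<partial>N)"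
      using N2 le by (intro integral_mono) auto
    hence "(\<integral>z. 1 - cos (\<xi> \<bullet> z) \<partial>N) \<le> m * (norm \<xi>)\<^sup>2"
      by (simp add: m_def mult_ac)
    moreover have "0 \<le> (\<integral>z. 1 - cos (\<xi> \<bullet> z) \<partial>N)"
      by (intro Bochner_Integration.integral_nonneg) auto
    ultimately show ?thesis using abs_le_D1[OF 1] abs_le_D2[OF 1]
      unfolding char_exponent_def distrib_right by (intro abs_leI) linarith+
  qed
  hence b: "\<bar>char_exponent A N \<xi>\<bar> \<le> \<bar>(B + m) * (norm \<xi>)\<^sup>2\<bar>" for \<xi> by (meson abs_ge_self order_trans)
  show "integrable Q (\<lambda>q. char_exponent A N (\<zeta> q))"
    by (rule Bochner_Integration.integrable_bound[where f="\<lambda>q. (B + m) * (norm (\<zeta> q))\<^sup>2"])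
      (use square_integrable b in auto)
qed

text \<open>The frequency integral is \<open>- L mix\<close> at \<open>x\<close>. The diffusion part
  and the small jumps are paid for by \<open>c\<close>, the large jumps by \<open>T\<close>.\<close>

lemma exponent_integral_lower:
  fixes N :: "(real^'d) measure" and A :: "real^'d^'d"
  assumes N: "sigma_finite_measure N" and sets[measurable_cong]: "sets N = sets borel"
    and N2: "integrable N (\<lambda>z. (norm z)\<^sup>2)" and sym: "symmetric_measure N"
    and nonneg: "\<And>x. 0 \<le> mix x"
    and s: "0 < s" and c: "\<And>z. norm z \<le> s \<Longrightarrow> \<bar>second_diff x z\<bar> \<le> c * (norm z)\<^sup>2" and c0: "0 \<le> c"
    and T: "(\<integral>\<^sup>+z\<in>{z. s < norm z}. ennreal (mix (x - z)) \<partial>N) \<le> ennreal T" and T0: "0 \<le> T"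
  shows "- (c * (4 * (\<Sum>i\<in>UNIV. \<Sum>j\<in>UNIV. \<bar>A $ i $ j\<bar>) + (\<integral>z. (norm z)\<^sup>2 \<partial>N)) + T)
    \<le> (\<integral>q. char_exponent A N (\<zeta> q) * cos (\<zeta> q \<bullet> x - \<phi> q) \<partial>Q)"
proof -
  have "(\<integral>q. char_exponent A N (\<zeta> q) * cos (\<zeta> q \<bullet> x - \<phi> q) \<partial>Q)
     = (\<integral>q. ((A *v \<zeta> q) \<bullet> \<zeta> q) * cos (\<zeta> q \<bullet> x - \<phi> q) \<partial>Q) + (\<integral>z. second_diff x z \<partial>N)"
    unfolding char_exponent_def distrib_right jump_integral(3)[OF N sets N2, symmetric]
    by (intro Bochner_Integration.integral_add quadratic_form_bound(1)[OF s c] jump_integral(1)[OF N sets N2])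
  thus ?thesis
    using quadratic_form_bound(2)[OF s c, of A]
      jump_integral_lower[OF N sets N2 sym nonneg c0 c T T0] by (simp add: algebra_simps)
qed

end

section \<open>Dynkin's formula\<close>

text \<open>A real characteristic function makes the expected sine vanish, so only one term of the
  addition formula survives.\<close>

lemma expectation_cos:
  fixes Y :: "'w \<Rightarrow> real^'d"
  assumes "prob_space M" and [measurable]: "Y \<in> borel_measurable M"
    and ch: "(\<integral>w. iexp (\<xi> \<bullet> Y w) \<partial>M) = complex_of_real e"
  shows "(\<integral>w. cos (a + \<xi> \<bullet> Y w) \<partial>M) = cos a * e"
proof -
  interpret prob_space M by fact
  have int: "integrable M (\<lambda>w. iexp (\<xi> \<bullet> Y w))"
    by (rule integrable_const_bound[where B=1]) auto
  have i1: "integrable M (\<lambda>w. cos (\<xi> \<bullet> Y w))" "integrable M (\<lambda>w. sin (\<xi> \<bullet> Y w))"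
    by (rule integrable_const_bound[where B=1]; simp)+
  have "(\<integral>w. cos (\<xi> \<bullet> Y w) \<partial>M) = e"
    using integral_Re[OF int] ch by (simp add: cis_conv_exp[symmetric])
  moreover have "(\<integral>w. sin (\<xi> \<bullet> Y w) \<partial>M) = 0"
    using integral_Im[OF int] ch by (simp add: cis_conv_exp[symmetric])
  ultimately show ?thesis using i1 by (simp add: cos_add)
qed

context cosine_mixture
begin

text \<open>The weight \<open>g\<close> lets one Fubini argument serve both \<open>mix\<close>
  itself, with \<open>g = 1\<close>, and its image under \<open>\<epsilon> - L\<close>, with
  \<open>g = \<epsilon> + \<psi> (\<zeta> q)\<close>.\<close>

lemma expectation_mixture:
  fixes Y :: "'w \<Rightarrow> real^'d"
  assumes M: "prob_space M" and Y[measurable]: "Y \<in> borel_measurable M"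
    and ch: "\<And>\<xi>. (\<integral>w. iexp (\<xi> \<bullet> Y w) \<partial>M) = complex_of_real (e \<xi>)"
    and g: "integrable Q g"
  shows "(\<integral>w. (\<integral>q. g q * cos (\<zeta> q \<bullet> (x + Y w) - \<phi> q) \<partial>Q) \<partial>M) = (\<integral>q. g q * (cos (\<zeta> q \<bullet> x - \<phi> q) * e (\<zeta> q)) \<partial>Q)"
proof -
  interpret M: prob_space M by fact
  interpret P: pair_sigma_finite M Q ..
  note [measurable] = borel_measurable_integrable[OF g]
  let ?f = "\<lambda>(w, q). g q * cos (\<zeta> q \<bullet> (x + Y w) - \<phi> q)"
  have int: "integrable (M \<Otimes>\<^sub>M Q) ?f"
  proof (rule integrable_pair_dominated[where a="\<lambda>_. 1" and b=g])
    show "sigma_finite_measure M" "sigma_finite_measure Q" ..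
    show "\<bar>?f (w, q)\<bar> \<le> \<bar>1\<bar> * \<bar>g q\<bar>" for w q by (simp add: abs_mult mult_left_le)
  qed (use g in auto)
  have "(\<integral>w. (\<integral>q. ?f (w, q) \<partial>Q) \<partial>M) = (\<integral>q. (\<integral>w. ?f (w, q) \<partial>M) \<partial>Q)"
    using P.Fubini_integral[of "\<lambda>w q. ?f (w, q)"] int by simp
  also have "\<dots> = (\<integral>q. g q * (cos (\<zeta> q \<bullet> x - \<phi> q) * e (\<zeta> q)) \<partial>Q)"
  proof (intro Bochner_Integration.integral_cong refl)
    fix q
    have "(\<integral>w. ?f (w, q) \<partial>M) = g q * (\<integral>w. cos ((\<zeta> q \<bullet> x - \<phi> q) + \<zeta> q \<bullet> Y w) \<partial>M)"
      by (simp add: inner_add_right algebra_simps)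
    thus "(\<integral>w. ?f (w, q) \<partial>M) = g q * (cos (\<zeta> q \<bullet> x - \<phi> q) * e (\<zeta> q))"
      using expectation_cos[OF M Y ch] by simp
  qed
  finally show ?thesis by simp
qed

text \<open>
  The generator \<open>L\<close> acts on \<open>cos (\<zeta> \<bullet> x - \<phi>)\<close> as multiplication by \<open>- \<psi> \<zeta>\<close>, so the hypothesis \<open>sup\<close>
  says \<open>L mix \<le> \<epsilon> mix\<close>.
\<close>

lemma mix_supermartingale:
  fixes X :: "real \<Rightarrow> 'w \<Rightarrow> real^'d"
  assumes M: "prob_space M" and X: "\<And>t. 0 \<le> t \<Longrightarrow> X t \<in> borel_measurable M"
    and ch: "\<And>t \<xi>. 0 \<le> t \<Longrightarrow> (\<integral>w. iexp (\<xi> \<bullet> X t w) \<partial>M) = complex_of_real (exp (- t * \<psi> \<xi>))"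
    and \<psi>[measurable]: "\<psi> \<in> borel_measurable borel" and \<psi>0: "\<And>\<xi>. 0 \<le> \<psi> \<xi>"
    and int\<psi>: "integrable Q (\<lambda>q. \<psi> (\<zeta> q))"
    and \<epsilon>: "0 \<le> \<epsilon>"
    and sup: "\<And>x. 0 \<le> \<epsilon> * mix x + (\<integral>q. \<psi> (\<zeta> q) * cos (\<zeta> q \<bullet> x - \<phi> q) \<partial>Q)"
    and t: "0 \<le> t"
  shows "(\<integral>w. mix (x + X t w) \<partial>M) \<le> exp (\<epsilon> * t) * mix x"
proof -
  let ?k = "\<lambda>q. \<epsilon> + \<psi> (\<zeta> q)"
  let ?c = "\<lambda>q. cos (\<zeta> q \<bullet> x - \<phi> q)"
  have exp_split: "exp (- u * (\<epsilon> + p)) = exp (- u * \<epsilon>) * exp (- u * p)" for u p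
    by (simp add: distrib_left mult_exp_exp)
  have k0: "0 \<le> ?k q" for q using \<epsilon> \<psi>0[of "\<zeta> q"] by simp
  have intk: "integrable Q ?k" using int\<psi> by simp
  have int\<psi>c: "integrable Q (\<lambda>q. \<psi> (\<zeta> q) * cos (\<zeta> q \<bullet> y - \<phi> q))" for y
    by (rule Bochner_Integration.integrable_bound[OF int\<psi>]) (auto simp: abs_mult mult_left_le)
  have sup': "0 \<le> (\<integral>q. ?k q * cos (\<zeta> q \<bullet> y - \<phi> q) \<partial>Q)" for y
  proof -
    have "(\<integral>q. ?k q * cos (\<zeta> q \<bullet> y - \<phi> q) \<partial>Q)
        = \<epsilon> * mix y + (\<integral>q. \<psi> (\<zeta> q) * cos (\<zeta> q \<bullet> y - \<phi> q) \<partial>Q)"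
      unfolding distrib_right mix_def using int\<psi>c integrable_cos by simp
    thus ?thesis using sup by simp
  qed
  \<comment> \<open>The integral is \<open>exp (- u * \<epsilon>)\<close> times the expectation of
    the nonnegative function \<open>\<epsilon> mix - L mix\<close> at \<open>x + X u\<close>.
    Formally it is also minus the \<open>u\<close>-derivative of
    \<open>exp (- u * \<epsilon>)\<close> times the expectation of
    \<open>mix (x + X u)\<close>.\<close>
  have pos: "0 \<le> (\<integral>q. ?k q * (?c q * exp (- u * ?k q)) \<partial>Q)" if u: "0 \<le> u" for u
  proof -
    have "0 \<le> exp (- u * \<epsilon>) * (\<integral>w. (\<integral>q. ?k q * cos (\<zeta> q \<bullet> (x + X u w) - \<phi> q) \<partial>Q) \<partial>M)"
      by (rule mult_nonneg_nonneg, simp, rule Bochner_Integration.integral_nonneg, rule sup')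
    also have "\<dots> = exp (- u * \<epsilon>) * (\<integral>q. ?k q * (?c q * exp (- u * \<psi> (\<zeta> q))) \<partial>Q)"
      using expectation_mixture[OF M X ch intk] u by simp
    also have "\<dots> = (\<integral>q. ?k q * (?c q * exp (- u * ?k q)) \<partial>Q)"
      by (subst integral_mult_right_zero[symmetric], intro Bochner_Integration.integral_cong refl)
        (unfold exp_split, simp only: mult_ac mult_1)
    finally show ?thesis .
  qed
  let ?f = "\<lambda>(u, q). indicator {0..t} u * (?k q * (?c q * exp (- u * ?k q)))"
  interpret P: pair_sigma_finite "lborel :: real measure" Q ..
  have int: "integrable (lborel \<Otimes>\<^sub>M Q) ?f"
  proof (rule integrable_pair_dominated[where a="indicator {0..t}" and b="?k"])
    show "sigma_finite_measure (lborel::real measure)" "sigma_finite_measure Q" ..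
    show "\<bar>?f (u, q)\<bar> \<le> \<bar>indicator {0..t} u\<bar> * \<bar>?k q\<bar>" for u q
    proof (cases "u \<in> {0..t}")
      case True
      hence "0 \<le> u * ?k q" using k0[of q] by simp
      hence "\<bar>?c q\<bar> * exp (- u * ?k q) \<le> 1 * 1" by (intro mult_mono) auto
      hence "?k q * (\<bar>?c q\<bar> * exp (- u * ?k q)) \<le> ?k q * (1 * 1)" using k0 by (intro mult_left_mono)
      thus ?thesis using True k0[of q] by (simp add: abs_mult)
    qed simp
  qed (use intk in \<open>auto simp: integrable_indicator_iff emeasure_lborel_Icc_eq\<close>)
  \<comment> \<open>Integration over \<open>{0..t}\<close>, with the order exchanged, turns this
    into the decrease of the discounted expectation from time 0 to time \<open>t\<close>.\<close>
  have "0 \<le> (\<integral>u. (\<integral>q. ?f (u, q) \<partial>Q) \<partial>lborel)"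
  proof (rule Bochner_Integration.integral_nonneg)
    show "0 \<le> (\<integral>q. ?f (u, q) \<partial>Q)" for u
    proof (cases "u \<in> {0..t}")
      case True
      with pos[of u] show ?thesis by simp
    qed simp
  qed
  also have "\<dots> = (\<integral>q. (\<integral>u. ?f (u, q) \<partial>lborel) \<partial>Q)"
    using P.Fubini_integral[of "\<lambda>u q. ?f (u, q)"] int by simp
  also have "\<dots> = (\<integral>q. ?c q - ?c q * exp (- t * ?k q) \<partial>Q)"
  proof (intro Bochner_Integration.integral_cong refl)
    fix q
    have D: "((\<lambda>u. - (a * exp (- u * k))) has_real_derivative k * (a * exp (- u * k))) (at u within S)"
      for a k u :: real and S
      by (auto intro!: derivative_eq_intros)
    have "(\<integral>u. indicator {0..t} u *\<^sub>R (?k q * (?c q * exp (- u * ?k q))) \<partial>lborel)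
        = - (?c q * exp (- t * ?k q)) - - (?c q * exp (- 0 * ?k q))"
    proof (rule integral_FTC_atLeastAtMost[OF t])
      fix u
      show "((\<lambda>u. - (?c q * exp (- u * ?k q))) has_vector_derivative ?k q * (?c q * exp (- u * ?k q))) (at u within {0..t})"
        unfolding has_real_derivative_iff_has_vector_derivative[symmetric]
        by (rule D)
    qed (intro continuous_intros)
    thus "(\<integral>u. ?f (u, q) \<partial>lborel) = ?c q - ?c q * exp (- t * ?k q)" by simp
  qed
  also have "\<dots> = mix x - (\<integral>q. ?c q * exp (- t * ?k q) \<partial>Q)"
  proof -
    have "integrable Q (\<lambda>q. ?c q * exp (- t * ?k q))"
    proof (rule integrable_const_bound[where B=1])
      have "\<bar>?c q\<bar> * exp (- t * ?k q) \<le> 1 * 1" for q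
        using t k0[of q] by (intro mult_mono) auto
      thus "AE q in Q. norm (?c q * exp (- t * ?k q)) \<le> 1" by (auto simp: abs_mult)
    qed measurable
    thus ?thesis using integrable_cos by (simp add: mix_def)
  qed
  also have "(\<integral>q. ?c q * exp (- t * ?k q) \<partial>Q) = exp (- t * \<epsilon>) * (\<integral>q. 1 * (?c q * exp (- t * \<psi> (\<zeta> q))) \<partial>Q)"
    by (subst integral_mult_right_zero[symmetric], intro Bochner_Integration.integral_cong refl)
      (unfold exp_split, simp only: mult_ac mult_1)
  also have "(\<integral>q. 1 * (?c q * exp (- t * \<psi> (\<zeta> q))) \<partial>Q) = (\<integral>w. mix (x + X t w) \<partial>M)"
    using expectation_mixture[OF M X[OF t] ch[OF t], of "\<lambda>_. 1" x] by (simp add: mix_def)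
  finally have "exp (- t * \<epsilon>) * (\<integral>w. mix (x + X t w) \<partial>M) \<le> mix x" by simp
  hence "exp (\<epsilon> * t) * (exp (- t * \<epsilon>) * (\<integral>w. mix (x + X t w) \<partial>M)) \<le> exp (\<epsilon> * t) * mix x"
    by (intro mult_left_mono) auto
  thus ?thesis unfolding mult.assoc[symmetric] mult_exp_exp by (simp add: mult.commute)
qed

end

section \<open>Hitting times on time grids\<close>

text \<open>This is the Markov property at a grid time. The event and the position at step
  \<open>k\<close> are functions of the first \<open>k\<close> increments; the next increment is
  independent of them and has the law of \<open>X \<delta>\<close>, so \<open>le\<close> applies at
  each fixed position.\<close>

lemma levy_process_step:
  fixes X :: "real \<Rightarrow> 'w \<Rightarrow> real^'d" and H :: "real^'d \<Rightarrow> ennreal"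
  assumes L: "levy_process M X" and [measurable]: "H \<in> borel_measurable borel"
    and U[measurable]: "U \<in> sets borel"
    and \<delta>: "0 \<le> \<delta>"
    and le: "\<And>y. (\<integral>\<^sup>+w. H (y + X \<delta> w) \<partial>M) \<le> C * H y"
  shows "(\<integral>\<^sup>+w. H (x + X (real (Suc k) * \<delta>) w) * indicator {w. \<forall>j\<le>k. x + X (real j * \<delta>) w \<notin> U} w \<partial>M)
    \<le> C * (\<integral>\<^sup>+w. H (x + X (real k * \<delta>) w) * indicator {w. \<forall>j\<le>k. x + X (real j * \<delta>) w \<notin> U} w \<partial>M)"
proof -
  interpret prob_space M using L by (simp add: levy_process_def)
  have X[measurable]: "X t \<in> borel_measurable M" if "0 \<le> t" for t
    using L that by (simp add: levy_process_def)
  have [measurable]: "X (real j * \<delta>) \<in> borel_measurable M" for j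
    using \<delta> by (intro X) simp
  define V where "V i w = X (real (Suc i) * \<delta>) w - X (real i * \<delta>) w" for i w
  have [measurable]: "V i \<in> borel_measurable M" for i
    unfolding V_def by measurable
  have mono: "real i * \<delta> \<le> real (Suc i) * \<delta>" for i
    using \<delta> by (intro mult_right_mono) auto
  have "indep_vars (\<lambda>_. borel) (\<lambda>i w. X (real (Suc i) * \<delta>) w - X (real i * \<delta>) w) {..<Suc k}"
    using L \<delta> mono unfolding levy_process_def
    by (elim conjE allE[of _ "Suc k"] allE[of _ "\<lambda>i. real i * \<delta>"]) auto
  hence ind: "indep_vars (\<lambda>_. borel) V {..<Suc k}"
    by (simp add: V_def[abs_def])
  \<comment> \<open>The increments are split into two independent blocks; the last increment is kept
    as a family over the single index \<open>k\<close> to fit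
    \<open>indep_var_restrict\<close>.\<close>
  let ?P = "PiM {..<k} (\<lambda>_. borel :: (real^'d) measure)"
  let ?W = "\<lambda>w. restrict (\<lambda>i. V i w) {..<k}"
  let ?Pk = "PiM {k} (\<lambda>_. borel :: (real^'d) measure)"
  let ?Y = "\<lambda>w. restrict (\<lambda>i. V i w) {k}"
  have "indep_var ?P ?W ?Pk ?Y"
    by (rule indep_var_restrict[OF ind]) auto
  hence Wm[measurable]: "?W \<in> measurable M ?P" and Ym[measurable]: "?Y \<in> measurable M ?Pk"
    and eq: "distr M ?P ?W \<Otimes>\<^sub>M distr M ?Pk ?Y = distr M (?P \<Otimes>\<^sub>M ?Pk) (\<lambda>w. (?W w, ?Y w))"
    by (auto simp: indep_var_distribution_eq)
  have dV: "distr M borel (V k) = distr M borel (X \<delta>)"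
  proof -
    have "distr M borel (\<lambda>w. X (real (Suc k) * \<delta>) w - X (real k * \<delta>) w)
        = distr M borel (X (real (Suc k) * \<delta> - real k * \<delta>))"
      using L mono[of k] \<delta> unfolding levy_process_def by auto
    thus ?thesis by (simp add: V_def[abs_def] algebra_simps)
  qed
  define \<Sigma> where "\<Sigma> j v = x + (\<Sum>i<j. v i)" for j and v :: "nat \<Rightarrow> real^'d"
  define B where "B v = (indicator {v. \<forall>j\<le>k. \<Sigma> j v \<notin> U} v :: ennreal)" for v
  have \<Sigma>m[measurable]: "\<Sigma> j \<in> borel_measurable ?P" if "j \<le> k" for j
    unfolding \<Sigma>_def using that by (intro borel_measurable_add borel_measurable_sum) auto
  have [measurable]: "B \<in> borel_measurable ?P"
    unfolding B_def indicator_def by measurable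
  \<comment> \<open>The sums \<open>\<Sigma> j\<close> recover the path only almost surely, because
    the process starts at 0 only almost surely.\<close>
  have "AE w in M. X 0 w = 0" using L by (simp add: levy_process_def)
  hence ae: "AE w in M. \<forall>j\<le>k. x + X (real j * \<delta>) w = \<Sigma> j (?W w)"
  proof eventually_elim
    case (elim w)
    have "(\<Sum>i<j. ?W w i) = X (real j * \<delta>) w" if "j \<le> k" for j
    proof -
      have "(\<Sum>i<j. ?W w i) = (\<Sum>i<j. X (real (Suc i) * \<delta>) w - X (real i * \<delta>) w)"
        using that by (intro sum.cong) (auto simp: V_def)
      also have "\<dots> = X (real j * \<delta>) w - X (real 0 * \<delta>) w"
        by (rule sum_lessThan_telescope)
      finally show ?thesis using elim by simp
    qed
    thus ?case by (simp add: \<Sigma>_def)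
  qed
  interpret D: prob_space "distr M ?Pk ?Y" by (rule prob_space_distr) simp
  have "(\<integral>\<^sup>+w. H (x + X (real (Suc k) * \<delta>) w) * indicator {w. \<forall>j\<le>k. x + X (real j * \<delta>) w \<notin> U} w \<partial>M)
      = (\<integral>\<^sup>+w. H (\<Sigma> k (?W w) + V k w) * B (?W w) \<partial>M)"
    using ae
  proof (intro nn_integral_cong_AE, eventually_elim)
    case (elim w)
    have "\<Sigma> k (?W w) = x + X (real k * \<delta>) w" using elim by simp
    hence "\<Sigma> k (?W w) + V k w = x + X (real (Suc k) * \<delta>) w" by (simp add: V_def)
    moreover have "B (?W w) = indicator {w. \<forall>j\<le>k. x + X (real j * \<delta>) w \<notin> U} w"
      using elim by (simp add: B_def indicator_def)
    ultimately show ?case by (simp only:)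
  qed
  also have "\<dots> = (\<integral>\<^sup>+p. H (\<Sigma> k (fst p) + snd p k) * B (fst p) \<partial>distr M (?P \<Otimes>\<^sub>M ?Pk) (\<lambda>w. (?W w, ?Y w)))"
    by (subst nn_integral_distr) auto
  also have "\<dots> = (\<integral>\<^sup>+p. H (\<Sigma> k (fst p) + snd p k) * B (fst p) \<partial>(distr M ?P ?W \<Otimes>\<^sub>M distr M ?Pk ?Y))"
    by (simp only: eq)
  also have "\<dots> = (\<integral>\<^sup>+v. (\<integral>\<^sup>+y. H (\<Sigma> k v + y k) * B v \<partial>distr M ?Pk ?Y) \<partial>distr M ?P ?W)"
    by (subst D.nn_integral_fst[symmetric]) auto
  also have "\<dots> = (\<integral>\<^sup>+v. B v * (\<integral>\<^sup>+w. H (\<Sigma> k v + X \<delta> w) \<partial>M) \<partial>distr M ?P ?W)"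
  proof (intro nn_integral_cong)
    fix v
    have "(\<integral>\<^sup>+y. H (\<Sigma> k v + y k) * B v \<partial>distr M ?Pk ?Y) = (\<integral>\<^sup>+w. H (\<Sigma> k v + V k w) \<partial>M) * B v"
      by (subst nn_integral_multc, simp, subst nn_integral_distr) auto
    also have "(\<integral>\<^sup>+w. H (\<Sigma> k v + V k w) \<partial>M) = (\<integral>\<^sup>+y. H (\<Sigma> k v + y) \<partial>distr M borel (V k))"
      by (subst nn_integral_distr) auto
    also have "\<dots> = (\<integral>\<^sup>+w. H (\<Sigma> k v + X \<delta> w) \<partial>M)"
      unfolding dV using X[OF \<delta>] by (subst nn_integral_distr) auto
    finally show "(\<integral>\<^sup>+y. H (\<Sigma> k v + y k) * B v \<partial>distr M ?Pk ?Y) = B v * (\<integral>\<^sup>+w. H (\<Sigma> k v + X \<delta> w) \<partial>M)"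
      by (simp only: mult.commute)
  qed
  also have "\<dots> \<le> (\<integral>\<^sup>+v. B v * (C * H (\<Sigma> k v)) \<partial>distr M ?P ?W)"
    using le by (intro nn_integral_mono mult_left_mono) auto
  also have "\<dots> = (\<integral>\<^sup>+v. C * (H (\<Sigma> k v) * B v) \<partial>distr M ?P ?W)"
    by (simp only: mult_ac)
  also have "\<dots> = (\<integral>\<^sup>+w. C * (H (\<Sigma> k (?W w)) * B (?W w)) \<partial>M)"
    by (subst nn_integral_distr) auto
  also have "\<dots> = C * (\<integral>\<^sup>+w. H (\<Sigma> k (?W w)) * B (?W w) \<partial>M)"
    by (rule nn_integral_cmult) measurable
  also have "(\<integral>\<^sup>+w. H (\<Sigma> k (?W w)) * B (?W w) \<partial>M)
      = (\<integral>\<^sup>+w. H (x + X (real k * \<delta>) w) * indicator {w. \<forall>j\<le>k. x + X (real j * \<delta>) w \<notin> U} w \<partial>M)"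
    using ae by (intro nn_integral_cong_AE, eventually_elim)
      (auto simp: B_def indicator_def)
  finally show ?thesis .
qed

definition grid_hit :: "(real \<Rightarrow> 'w \<Rightarrow> real^'d) \<Rightarrow> real^'d \<Rightarrow> (real^'d) set \<Rightarrow> real \<Rightarrow> nat \<Rightarrow> 'w set" where
  "grid_hit X x U \<delta> k = {w. x + X (real k * \<delta>) w \<in> U \<and> (\<forall>j<k. x + X (real j * \<delta>) w \<notin> U)}"

text \<open>At most one summand is nonzero, so this is \<open>exp (- \<eta> * T)\<close> for the
  first grid time \<open>T\<close> spent in \<open>U\<close>. It is 0 if there is none, in
  accordance with the convention for infinite hitting times.\<close>

definition grid_laplace :: "(real \<Rightarrow> 'w \<Rightarrow> real^'d) \<Rightarrow> real^'d \<Rightarrow> (real^'d) set \<Rightarrow> real \<Rightarrow> real \<Rightarrow> 'w \<Rightarrow> ennreal" where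
  "grid_laplace X x U \<eta> \<delta> w = (\<Sum>k. ennreal (exp (- \<eta> * (real k * \<delta>))) * indicator (grid_hit X x U \<delta> k) w)"

text \<open>Optional stopping as a telescoping sum: \<open>E k\<close> is the discounted mean of
  \<open>H\<close> on paths that have not entered \<open>U\<close> before step \<open>k\<close>, and
  \<open>F k\<close> is the discounted probability of entering at step \<open>k\<close>. Each step
  satisfies \<open>F k + E (Suc k) \<le> E k\<close>, and \<open>E 0 = H x\<close>.\<close>

lemma grid_laplace_le:
  fixes X :: "real \<Rightarrow> 'w \<Rightarrow> real^'d" and H :: "real^'d \<Rightarrow> ennreal"
  assumes L: "levy_process M X" and [measurable]: "H \<in> borel_measurable borel"
    and U[measurable]: "U \<in> sets borel"
    and \<delta>: "0 \<le> \<delta>"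
    and le: "\<And>y. (\<integral>\<^sup>+w. H (y + X \<delta> w) \<partial>M) \<le> ennreal (exp (\<eta> * \<delta>)) * H y"
    and c: "\<And>y. y \<in> U \<Longrightarrow> 1 \<le> H y"
  shows "grid_laplace X x U \<eta> \<delta> \<in> borel_measurable M"
    and "(\<integral>\<^sup>+w. grid_laplace X x U \<eta> \<delta> w \<partial>M) \<le> H x"
proof -
  interpret prob_space M using L by (simp add: levy_process_def)
  have X[measurable]: "X t \<in> borel_measurable M" if "0 \<le> t" for t
    using L that by (simp add: levy_process_def)
  have [measurable]: "X (real j * \<delta>) \<in> borel_measurable M" for j
    using \<delta> by (intro X) simp
  have [measurable]: "(\<lambda>w. indicator (grid_hit X x U \<delta> k) w :: ennreal) \<in> borel_measurable M" for k
    unfolding grid_hit_def indicator_def by measurable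
  show "grid_laplace X x U \<eta> \<delta> \<in> borel_measurable M"
    unfolding grid_laplace_def[abs_def] by measurable
  define e where "e k = ennreal (exp (- \<eta> * (real k * \<delta>)))" for k
  \<comment> \<open>One step of discounting cancels exactly the growth allowed by
    \<open>le\<close>.\<close>
  have e_Suc: "e (Suc k) * ennreal (exp (\<eta> * \<delta>)) = e k" for k
    by (simp add: e_def mult_exp_exp algebra_simps flip: ennreal_mult)
  have [measurable]: "(\<lambda>w. indicator {w. \<forall>j\<le>k. x + X (real j * \<delta>) w \<notin> U} w :: ennreal) \<in> borel_measurable M"
    "(\<lambda>w. indicator {w. \<forall>j<k. x + X (real j * \<delta>) w \<notin> U} w :: ennreal) \<in> borel_measurable M" for k
    unfolding indicator_def by measurable
  define E where "E k = e k * (\<integral>\<^sup>+w. H (x + X (real k * \<delta>) w) * indicator {w. \<forall>j<k. x + X (real j * \<delta>) w \<notin> U} w \<partial>M)" for k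
  define F where "F k = (\<integral>\<^sup>+w. e k * indicator (grid_hit X x U \<delta> k) w \<partial>M)" for k
  have step: "F k + E (Suc k) \<le> E k" for k
  proof -
    let ?N = "\<integral>\<^sup>+w. H (x + X (real k * \<delta>) w) * indicator {w. \<forall>j\<le>k. x + X (real j * \<delta>) w \<notin> U} w \<partial>M"
    let ?H = "\<integral>\<^sup>+w. H (x + X (real k * \<delta>) w) * indicator (grid_hit X x U \<delta> k) w \<partial>M"
    have "E (Suc k) \<le> e (Suc k) * (ennreal (exp (\<eta> * \<delta>)) * ?N)"
      unfolding E_def less_Suc_eq_le by (intro mult_left_mono levy_process_step[OF L _ U \<delta> le]) auto
    also have "\<dots> = e k * ?N" by (simp add: e_Suc flip: mult.assoc)
    finally have 1: "E (Suc k) \<le> e k * ?N" .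
    have "F k = e k * (\<integral>\<^sup>+w. indicator (grid_hit X x U \<delta> k) w \<partial>M)"
      unfolding F_def by (simp add: nn_integral_cmult mult_ac)
    also have "\<dots> \<le> e k * ?H"
      using c by (intro mult_left_mono nn_integral_mono) (auto simp: indicator_def grid_hit_def)
    finally have "F k + E (Suc k) \<le> e k * ?H + e k * ?N" using 1 by (rule add_mono)
    also have "\<dots> = e k * (\<integral>\<^sup>+w. H (x + X (real k * \<delta>) w) * indicator (grid_hit X x U \<delta> k) w
       + H (x + X (real k * \<delta>) w) * indicator {w. \<forall>j\<le>k. x + X (real j * \<delta>) w \<notin> U} w \<partial>M)"
      using \<delta> by (subst nn_integral_add) (auto simp: distrib_left)
    also have "\<dots> \<le> E k"
      unfolding E_def
    proof (intro mult_left_mono nn_integral_mono zero_le)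
      fix w
      show "H (x + X (real k * \<delta>) w) * indicator (grid_hit X x U \<delta> k) w
          + H (x + X (real k * \<delta>) w) * indicator {w. \<forall>j\<le>k. x + X (real j * \<delta>) w \<notin> U} w
        \<le> H (x + X (real k * \<delta>) w) * indicator {w. \<forall>j<k. x + X (real j * \<delta>) w \<notin> U} w"
      proof (cases "\<forall>j<k. x + X (real j * \<delta>) w \<notin> U")
        case True
        hence "(\<forall>j\<le>k. x + X (real j * \<delta>) w \<notin> U) \<longleftrightarrow> x + X (real k * \<delta>) w \<notin> U"
          by (auto simp: le_less)
        with True show ?thesis by (simp add: grid_hit_def indicator_def)
      next
        case False
        hence "\<not> (\<forall>j\<le>k. x + X (real j * \<delta>) w \<notin> U)" by (auto simp: le_less)
        with False show ?thesis by (simp add: grid_hit_def indicator_def)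
      qed
    qed
    finally show ?thesis .
  qed
  have tele: "(\<Sum>k<n. F k) + E n \<le> E 0" for n
  proof (induction n)
    case (Suc n)
    have "(\<Sum>k<Suc n. F k) + E (Suc n) = (\<Sum>k<n. F k) + (F n + E (Suc n))"
      by (simp add: add_ac)
    also have "\<dots> \<le> (\<Sum>k<n. F k) + E n" by (intro add_left_mono step)
    also note Suc.IH
    finally show ?case .
  qed simp
  have "AE w in M. X 0 w = 0" using L by (simp add: levy_process_def)
  hence "(\<integral>\<^sup>+w. H (x + X 0 w) \<partial>M) = (\<integral>\<^sup>+w. H x \<partial>M)"
    by (intro nn_integral_cong_AE, eventually_elim) simp
  moreover have "E 0 = (\<integral>\<^sup>+w. H (x + X 0 w) \<partial>M)"
    by (simp add: E_def e_def)
  ultimately have E0: "E 0 = H x" by (simp add: emeasure_space_1)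
  have "(\<integral>\<^sup>+w. grid_laplace X x U \<eta> \<delta> w \<partial>M) = (\<Sum>k. F k)"
    unfolding grid_laplace_def F_def e_def by (subst nn_integral_suminf) auto
  also have "\<dots> \<le> H x"
    using tele E0 by (intro suminf_le_const summableI) (metis le_iff_add order_trans)
  finally show "(\<integral>\<^sup>+w. grid_laplace X x U \<eta> \<delta> w \<partial>M) \<le> H x" .
qed

text \<open>The path is in \<open>K\<close> at some time \<open>t0\<close> barely later than the
  infimum. Right continuity keeps it in the open set \<open>U\<close> for a while after
  \<open>t0\<close>, and a fine enough grid has a point in that window, so the first grid visit to
  \<open>U\<close> comes no later.\<close>

lemma exit_laplace_path:
  fixes X :: "real \<Rightarrow> 'w \<Rightarrow> real^'d"
  assumes cad: "cadlag (\<lambda>t. X t w)" and U: "open U" "K \<subseteq> U" and \<eta>: "0 \<le> \<eta>"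
    and fin: "exit_time X x (- K) w \<noteq> \<infinity>"
  shows "ennreal (exp (- \<eta> * enn2real (exit_time X x (- K) w)))
    \<le> liminf (\<lambda>n. grid_laplace X x U \<eta> (1 / real (Suc n)) w)"
proof -
  define \<tau> where "\<tau> = enn2real (exit_time X x (- K) w)"
  have \<tau>: "exit_time X x (- K) w = ennreal \<tau>" and \<tau>0: "0 \<le> \<tau>"
    using fin by (auto simp: \<tau>_def less_top)
  have main: "ennreal (exp (- \<eta> * (\<tau> + \<rho>))) \<le> liminf (\<lambda>n. grid_laplace X x U \<eta> (1 / real (Suc n)) w)"
    if \<rho>: "0 < \<rho>" for \<rho>
  proof -
    have "exit_time X x (- K) w < ennreal (\<tau> + \<rho>)"
      unfolding \<tau> using \<rho> \<tau>0 by (simp add: ennreal_lessI)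
    then obtain t0 where t0: "0 \<le> t0" "x + X t0 w \<in> K" "t0 < \<tau> + \<rho>"
      unfolding exit_time_def by (auto simp: INF_less_iff ennreal_less_iff)
    have "((\<lambda>t. X t w) \<longlongrightarrow> X t0 w) (at_right t0)"
      using cad t0 by (simp add: cadlag_def)
    hence "((\<lambda>t. x + X t w) \<longlongrightarrow> x + X t0 w) (at_right t0)" by (intro tendsto_intros)
    hence "eventually (\<lambda>t. x + X t w \<in> U) (at_right t0)"
      using U t0 by (auto dest!: topological_tendstoD)
    then obtain b where b: "t0 < b" "\<And>t. t0 < t \<Longrightarrow> t < b \<Longrightarrow> x + X t w \<in> U"
      unfolding eventually_at_right_field by blast
    \<comment> \<open>On the window of length \<open>d\<close> after \<open>t0\<close> the path lies
      in \<open>U\<close> and time stays below \<open>\<tau> + \<rho>\<close>.\<close>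
    define d where "d = min b (\<tau> + \<rho>) - t0"
    have d: "0 < d" using b t0 by (simp add: d_def)
    have "eventually (\<lambda>n. 1 / real (Suc n) < d) sequentially"
      using LIMSEQ_inverse_real_of_nat d by (auto dest!: order_tendstoD(2) simp: inverse_eq_divide)
    hence "eventually (\<lambda>n. ennreal (exp (- \<eta> * (\<tau> + \<rho>))) \<le> grid_laplace X x U \<eta> (1 / real (Suc n)) w) sequentially"
    proof eventually_elim
      case (elim n)
      define \<delta> where "\<delta> = 1 / real (Suc n)"
      have \<delta>: "0 < \<delta>" "\<delta> < d" using elim by (simp_all add: \<delta>_def)
      \<comment> \<open>Adding 1 to the floor puts the grid point strictly after \<open>t0\<close>,
        as \<open>b(2)\<close> requires, and at most \<open>\<delta>\<close> later.\<close>
      define k where "k = nat \<lfloor>t0 / \<delta>\<rfloor> + 1"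
      have "0 \<le> t0 / \<delta>" using t0 \<delta> by simp
      hence k: "t0 / \<delta> < real k" "real k \<le> t0 / \<delta> + 1"
        unfolding k_def by (simp_all add: of_nat_nat) linarith
      have k': "t0 < real k * \<delta>" "real k * \<delta> \<le> t0 + \<delta>"
        using k \<delta> by (simp_all add: field_simps)
      hence kU: "x + X (real k * \<delta>) w \<in> U" and k\<tau>: "real k * \<delta> < \<tau> + \<rho>"
        using b(2) \<delta> by (auto simp: d_def)
      define j where "j = (LEAST j. x + X (real j * \<delta>) w \<in> U)"
      have jU: "x + X (real j * \<delta>) w \<in> U" unfolding j_def by (rule LeastI) (rule kU)
      have jk: "j \<le> k" unfolding j_def by (rule Least_le) (rule kU)
      have "x + X (real i * \<delta>) w \<notin> U" if "i < j" for i
        using not_less_Least that unfolding j_def by blast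
      hence hit: "w \<in> grid_hit X x U \<delta> j" using jU by (simp add: grid_hit_def)
      have "real j * \<delta> \<le> real k * \<delta>" using jk \<delta> by (intro mult_right_mono) auto
      hence "ennreal (exp (- \<eta> * (\<tau> + \<rho>))) \<le> ennreal (exp (- \<eta> * (real j * \<delta>)))"
        using k\<tau> \<eta> by (intro ennreal_leI) (simp add: mult_left_mono)
      also have "\<dots> = (\<Sum>k\<in>{j}. ennreal (exp (- \<eta> * (real k * \<delta>))) * indicator (grid_hit X x U \<delta> k) w)"
        using hit by simp
      also have "\<dots> \<le> grid_laplace X x U \<eta> \<delta> w"
        unfolding grid_laplace_def by (intro sum_le_suminf summableI) auto
      finally show ?case by (simp add: \<delta>_def)
    qed
    thus ?thesis by (rule Liminf_bounded)
  qed
  \<comment> \<open>The slack \<open>\<rho>\<close>, which covers an infimum that is not attained,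
    is now sent to 0.\<close>
  have "(\<lambda>n. ennreal (exp (- \<eta> * (\<tau> + inverse (real (Suc n)))))) \<longlonglongrightarrow> ennreal (exp (- \<eta> * (\<tau> + 0)))"
    by (intro tendsto_ennrealI tendsto_intros LIMSEQ_inverse_real_of_nat)
  hence "ennreal (exp (- \<eta> * (\<tau> + 0))) \<le> liminf (\<lambda>n. grid_laplace X x U \<eta> (1 / real (Suc n)) w)"
    by (rule LIMSEQ_le_const2) (intro exI[of _ 0] allI impI main, simp)
  thus ?thesis by (simp add: \<tau>_def)
qed

text \<open>The transform is dominated pathwise by the lower limit over the grids of mesh
  \<open>1 / real (Suc n)\<close>. Fatou's lemma takes the limit outside, where every grid obeys the
  same bound \<open>H x\<close>.\<close>

lemma exit_laplace_le_supermartingale: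
  fixes X :: "real \<Rightarrow> 'w \<Rightarrow> real^'d" and H :: "real^'d \<Rightarrow> ennreal"
  assumes L: "levy_process M X" and H: "H \<in> borel_measurable borel"
    and U: "open U" "K \<subseteq> U" and \<eta>: "0 \<le> \<eta>"
    and le: "\<And>t y. 0 \<le> t \<Longrightarrow> (\<integral>\<^sup>+w. H (y + X t w) \<partial>M) \<le> ennreal (exp (\<eta> * t)) * H y"
    and c: "\<And>y. y \<in> U \<Longrightarrow> 1 \<le> H y"
  shows "exit_laplace M X (- K) \<eta> x \<le> H x"
proof -
  let ?\<Phi> = "\<lambda>n. grid_laplace X x U \<eta> (1 / real (Suc n))"
  have U': "U \<in> sets borel" using U by simp
  have m: "?\<Phi> n \<in> borel_measurable M" for n
    by (rule grid_laplace_le(1)[OF L H U' _ le c]) auto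
  have "AE w in M. cadlag (\<lambda>t. X t w)" using L by (simp add: levy_process_def)
  hence "AE w in completion M. cadlag (\<lambda>t. X t w)" by (rule AE_completion)
  hence "exit_laplace M X (- K) \<eta> x \<le> (\<integral>\<^sup>+w. liminf (\<lambda>n. ?\<Phi> n w) \<partial>completion M)"
    unfolding exit_laplace_def
    by (intro nn_integral_mono_AE, eventually_elim)
      (simp only: split: if_split, intro conjI impI zero_le exit_laplace_path[OF _ U \<eta>])
  also have "\<dots> = (\<integral>\<^sup>+w. liminf (\<lambda>n. ?\<Phi> n w) \<partial>M)"
    by (rule nn_integral_completion)
  also have "\<dots> \<le> liminf (\<lambda>n. \<integral>\<^sup>+w. ?\<Phi> n w \<partial>M)"
    using m by (rule nn_integral_liminf)
  also have "\<dots> \<le> limsup (\<lambda>n. \<integral>\<^sup>+w. ?\<Phi> n w \<partial>M)"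
    by (rule Liminf_le_Limsup) simp
  also have "\<dots> \<le> H x"
    by (rule Limsup_bounded, intro always_eventually allI grid_laplace_le(2)[OF L H U' _ le c]) auto
  finally show ?thesis .
qed

section \<open>Gaussian smoothing of slowly varying weights\<close>

lemma lborel_affine_scaleR:
  fixes t :: "'a::euclidean_space"
  assumes "s \<noteq> 0"
  shows "lborel = density (distr lborel borel (\<lambda>u::'a. t + s *\<^sub>R u)) (\<lambda>_. ennreal (\<bar>s\<bar> ^ DIM('a)))"
proof -
  have "(\<Sum>j\<in>Basis. (s * (x \<bullet> j)) *\<^sub>R j) = s *\<^sub>R x" for x :: 'a
    using euclidean_representation[of x] by (simp add: scaleR_sum_right[symmetric] flip: scaleR_scaleR)
  thus ?thesis
    using lborel_affine_euclidean[of "\<lambda>_. s" t] assms by (simp add: prod_constant)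
qed

lemma lborel_integral_affine:
  fixes f :: "'a::euclidean_space \<Rightarrow> real"
  assumes [measurable]: "f \<in> borel_measurable borel" and s: "s \<noteq> 0"
  shows "integral\<^sup>L lborel f = \<bar>s\<bar> ^ DIM('a) * (\<integral>u. f (t + s *\<^sub>R u) \<partial>lborel)"
    and "integrable lborel f \<Longrightarrow> integrable lborel (\<lambda>u. f (t + s *\<^sub>R u))"
proof -
  show "integral\<^sup>L lborel f = \<bar>s\<bar> ^ DIM('a) * (\<integral>u. f (t + s *\<^sub>R u) \<partial>lborel)"
    by (subst lborel_affine_scaleR[OF s, of t], subst integral_density) (auto simp: integral_distr)
  assume "integrable lborel f"
  hence "integrable (density (distr lborel borel (\<lambda>u::'a. t + s *\<^sub>R u)) (\<lambda>_. ennreal (\<bar>s\<bar> ^ DIM('a)))) f"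
    by (subst lborel_affine_scaleR[OF s, of t, symmetric])
  hence "integrable lborel (\<lambda>u. \<bar>s\<bar> ^ DIM('a) * f (t + s *\<^sub>R u))"
    by (subst (asm) integrable_density) (auto simp: integrable_distr_eq)
  thus "integrable lborel (\<lambda>u. f (t + s *\<^sub>R u))" using s by simp
qed

text \<open>A displacement \<open>w\<close> is covered in about \<open>norm w / \<sigma>\<close>
  steps of length at most \<open>\<sigma>\<close>, each costing a factor \<open>\<kappa>\<close>.
  Rounding the number of steps up costs the extra factor \<open>\<kappa>\<close> in front.\<close>

lemma slow_variation_exp:
  fixes F :: "'a::real_normed_vector \<Rightarrow> real"
  assumes \<kappa>: "1 \<le> \<kappa>" and \<sigma>: "0 < \<sigma>" and F0: "\<And>x. 0 \<le> F x"
    and slow: "\<And>x y. norm y \<le> \<sigma> \<Longrightarrow> F (x - y) \<le> \<kappa> * F x"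
  shows "F (x - w) \<le> \<kappa> * exp (ln \<kappa> * (norm w / \<sigma>)) * F x"
proof -
  have iter: "F (x - w) \<le> \<kappa> ^ n * F x" if "norm w \<le> real n * \<sigma>" for n x w
    using that
  proof (induction n arbitrary: x w)
    case (Suc n)
    define v where "v = (1 / real (Suc n)) *\<^sub>R w"
    have "norm v \<le> \<sigma>" using Suc.prems by (simp add: v_def field_simps)
    have wv: "w - v = (real n / real (Suc n)) *\<^sub>R w"
      unfolding v_def scaleR_left_diff_distrib[symmetric, of 1, simplified]
      by (simp add: scaleR_left_diff_distrib[of 1, simplified, symmetric] diff_divide_distrib field_simps)
    have "norm (w - v) = real n / real (Suc n) * norm w" unfolding wv by simp
    also have "\<dots> \<le> real n / real (Suc n) * (real (Suc n) * \<sigma>)"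
      using Suc.prems by (intro mult_left_mono) auto
    also have "\<dots> = real n * \<sigma>" by simp
    finally have "F ((x - v) - (w - v)) \<le> \<kappa> ^ n * F (x - v)" by (rule Suc.IH)
    also have "\<dots> \<le> \<kappa> ^ n * (\<kappa> * F x)"
      using slow[OF \<open>norm v \<le> \<sigma>\<close>] \<kappa> by (intro mult_left_mono) auto
    finally show ?case by (simp add: mult_ac)
  qed simp
  define n where "n = nat \<lceil>norm w / \<sigma>\<rceil>"
  have n: "norm w / \<sigma> \<le> real n" "real n \<le> norm w / \<sigma> + 1"
    unfolding n_def using \<sigma> by (simp_all add: of_nat_nat)
  have "norm w \<le> real n * \<sigma>" using n \<sigma> by (simp add: field_simps)
  hence "F (x - w) \<le> \<kappa> ^ n * F x" by (rule iter)
  also have "\<kappa> ^ n = exp (ln \<kappa> * real n)" using \<kappa> by (simp add: exp_of_nat2_mult)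
  also have "exp (ln \<kappa> * real n) * F x \<le> exp (ln \<kappa> * (norm w / \<sigma> + 1)) * F x"
    using n \<kappa> F0 by (intro mult_right_mono) (auto intro!: mult_left_mono)
  also have "exp (ln \<kappa> * (norm w / \<sigma> + 1)) = \<kappa> * exp (ln \<kappa> * (norm w / \<sigma>))"
    using \<kappa> by (simp add: distrib_left exp_add)
  finally show ?thesis .
qed

text \<open>The mixing measure draws \<open>y\<close> with density \<open>F\<close> and an
  independent normal vector \<open>Z\<close>, with frequency \<open>Z /\<^sub>R \<sigma>\<close> and
  a phase that centres the wave at \<open>y\<close>. Averaging over \<open>Z\<close> gives the
  Gaussian kernel, averaging over \<open>y\<close> the convolution.\<close>

lemma gaussian_mixture_exists:
  fixes F :: "real^'d \<Rightarrow> real"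
  assumes \<sigma>: "0 < \<sigma>" and F0: "\<And>x. 0 \<le> F x" and F: "integrable lborel F"
    and Fm[measurable]: "F \<in> borel_measurable borel"
  shows "\<exists>(Q :: ((real^'d) \<times> (real^'d \<Rightarrow> real)) measure) \<zeta> \<phi>. cosine_mixture Q \<zeta> \<phi> \<and>
    (\<forall>x. cosine_mixture.mix Q \<zeta> \<phi> x = (\<integral>y. F y * exp (- (norm ((x - y) /\<^sub>R \<sigma>))\<^sup>2 / 2) \<partial>lborel))"
proof -
  define G where "G = PiM (Basis :: (real^'d) set) (\<lambda>_. std_normal_distribution)"
  define Z where "Z = (\<lambda>w. \<Sum>b\<in>(Basis :: (real^'d) set). w b *\<^sub>R b)"
  note GZ = gaussian_cos_representation[where 'a="real^'d", folded G_def Z_def]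
  have [measurable]: "Z \<in> borel_measurable G"
    and Z2: "integrable G (\<lambda>w. (norm (Z w))\<^sup>2)"
    and Zcos: "(\<integral>w. cos (Z w \<bullet> u) \<partial>G) = exp (- (norm u)\<^sup>2 / 2)" for u
    using GZ(2-4) by (simp_all add: Z_def)
  interpret G: prob_space G by (rule GZ(1))
  define D where "D = density lborel (\<lambda>y. ennreal (F y))"
  have "emeasure D (space D) < \<infinity>"
    using F F0 unfolding D_def by (simp add: emeasure_density nn_integral_eq_integral)
  then interpret D: finite_measure D by (intro finite_measureI) simp
  have sD[measurable_cong]: "sets D = sets borel" by (simp add: D_def)
  interpret P: pair_sigma_finite D G ..
  define \<zeta> :: "(real^'d) \<times> (real^'d \<Rightarrow> real) \<Rightarrow> real^'d" where "\<zeta> q = Z (snd q) /\<^sub>R \<sigma>" for q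
  define \<phi> :: "(real^'d) \<times> (real^'d \<Rightarrow> real) \<Rightarrow> real" where "\<phi> q = (Z (snd q) /\<^sub>R \<sigma>) \<bullet> fst q" for q
  have [measurable]: "\<zeta> \<in> borel_measurable (D \<Otimes>\<^sub>M G)" "\<phi> \<in> borel_measurable (D \<Otimes>\<^sub>M G)"
    unfolding \<zeta>_def[abs_def] \<phi>_def[abs_def] by measurable
  interpret cosine_mixture "D \<Otimes>\<^sub>M G" \<zeta> \<phi>
  proof (intro cosine_mixture.intro cosine_mixture_axioms.intro)
    show "finite_measure (D \<Otimes>\<^sub>M G)"
      using finite_measure_pair_measure[OF G.finite_measure_axioms D.finite_measure_axioms] .
    show "integrable (D \<Otimes>\<^sub>M G) (\<lambda>q. (norm (\<zeta> q))\<^sup>2)"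
    proof (rule integrable_pair_dominated[where a="\<lambda>_. 1" and b="\<lambda>w. (norm (Z w))\<^sup>2 * (1 / \<sigma>)\<^sup>2"])
      show "integrable G (\<lambda>w. (norm (Z w))\<^sup>2 * (1 / \<sigma>)\<^sup>2)" using Z2 by simp
      show "\<bar>(norm (\<zeta> (y, w)))\<^sup>2\<bar> \<le> \<bar>1\<bar> * \<bar>(norm (Z w))\<^sup>2 * (1 / \<sigma>)\<^sup>2\<bar>" for y w
        using \<sigma> by (simp add: \<zeta>_def power_divide field_simps)
    qed (auto intro: D.sigma_finite_measure_axioms G.sigma_finite_measure_axioms)
  qed measurable
  have "mix x = (\<integral>y. F y * exp (- (norm ((x - y) /\<^sub>R \<sigma>))\<^sup>2 / 2) \<partial>lborel)" for x
  proof -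
    have "mix x = (\<integral>y. (\<integral>w. cos (\<zeta> (y, w) \<bullet> x - \<phi> (y, w)) \<partial>G) \<partial>D)"
      unfolding mix_def by (rule P.integral_fst'[symmetric]) (rule integrable_cos)
    also have "\<dots> = (\<integral>y. exp (- (norm ((x - y) /\<^sub>R \<sigma>))\<^sup>2 / 2) \<partial>D)"
    proof (intro Bochner_Integration.integral_cong refl)
      fix y
      have "(\<integral>w. cos (\<zeta> (y, w) \<bullet> x - \<phi> (y, w)) \<partial>G) = (\<integral>w. cos (Z w \<bullet> ((x - y) /\<^sub>R \<sigma>)) \<partial>G)"
        by (simp add: \<zeta>_def \<phi>_def inner_diff_right right_diff_distrib)
      thus "(\<integral>w. cos (\<zeta> (y, w) \<bullet> x - \<phi> (y, w)) \<partial>G) = exp (- (norm ((x - y) /\<^sub>R \<sigma>))\<^sup>2 / 2)"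
        by (simp only: Zcos)
    qed
    also have "\<dots> = (\<integral>y. F y * exp (- (norm ((x - y) /\<^sub>R \<sigma>))\<^sup>2 / 2) \<partial>lborel)"
      unfolding D_def using F0 by (subst integral_density) auto
    finally show ?thesis .
  qed
  thus ?thesis using cosine_mixture_axioms by blast
qed

text \<open>After rescaling by \<open>\<sigma>\<close>, slow variation compares \<open>F\<close>
  near \<open>x\<close> with \<open>F x\<close> up to an exponential, which the Gaussian integrates.
  The order of quantifiers matters: \<open>C\<close> depends on \<open>\<kappa>\<close> and the
  dimension only, so it can be fixed before \<open>\<sigma>\<close> and \<open>F\<close> are chosen.
  The factor \<open>D\<close> absorbs the missing normalization of the kernel.\<close>

lemma slowly_varying_mixture:
  assumes \<kappa>: "1 \<le> \<kappa>"
  shows "\<exists>C>0. \<forall>\<sigma>>0. \<forall>F :: real^'d \<Rightarrow> real.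
    (\<forall>x. 0 \<le> F x) \<and> integrable lborel F \<and> F \<in> borel_measurable borel \<and>
    (\<forall>x y. norm y \<le> \<sigma> \<longrightarrow> F (x - y) \<le> \<kappa> * F x) \<longrightarrow>
    (\<exists>(Q :: ((real^'d) \<times> (real^'d \<Rightarrow> real)) measure) \<zeta> \<phi> D. cosine_mixture Q \<zeta> \<phi> \<and> 0 < D \<and>
      (\<forall>x. 0 \<le> cosine_mixture.mix Q \<zeta> \<phi> x \<and> cosine_mixture.mix Q \<zeta> \<phi> x \<le> D * F x \<and>
        D * F x \<le> C * cosine_mixture.mix Q \<zeta> \<phi> x) \<and>
      (\<forall>x z. norm z \<le> \<sigma> \<longrightarrow> \<bar>cosine_mixture.second_diff Q \<zeta> \<phi> x z\<bar> \<le> C * (norm z / \<sigma>)\<^sup>2 * cosine_mixture.mix Q \<zeta> \<phi> x))"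
proof -
  define b where "b = ln \<kappa>"
  have b: "0 \<le> b" using \<kappa> by (simp add: b_def)
  \<comment> \<open>One family covers every kernel in use: \<open>c = 0\<close> is the Gaussian,
    \<open>b\<close> accounts for the growth of \<open>F\<close>, \<open>2\<close> for the second
    difference bound, and \<open>- b\<close> for the lower bound.\<close>
  define k where "k c u = exp (- (norm (u :: real^'d))\<^sup>2 / 2 + c * norm u)" for c u
  define J where "J c = (\<integral>u. k c u \<partial>lborel)" for c
  have [measurable]: "k c \<in> borel_measurable borel" for c unfolding k_def by measurable
  have k0: "0 < k c u" for c u by (simp add: k_def)
  have kint: "integrable lborel (k c)" for c
    using nn_integral_gaussian_exp_finite[where 'a="real^'d", of c]
    by (intro integrableI_bounded) (auto simp: k_def)
  have kk: "k c u * exp (d * norm u) = k (c + d) u" for c d u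
    by (simp add: k_def mult_exp_exp algebra_simps)
  have J0: "0 < J c" for c
  proof -
    have "J c \<noteq> 0"
    proof
      assume "J c = 0"
      hence "AE u in (lborel :: (real^'d) measure). k c u = 0"
        unfolding J_def using kint[of c] k0
        by (subst (asm) integral_nonneg_eq_0_iff_AE) (auto simp: less_imp_le)
      hence "AE u in (lborel :: (real^'d) measure). False"
        by eventually_elim (use k0 less_irrefl in metis)
      thus False by (simp add: eventually_False ae_filter_eq_bot_iff)
    qed
    moreover have "0 \<le> J c" unfolding J_def using k0 by (intro Bochner_Integration.integral_nonneg) (simp add: less_imp_le)
    ultimately show ?thesis by simp
  qed
  have Jmono: "J b \<le> J (b + 2)"
    unfolding J_def by (intro integral_mono kint) (simp add: k_def mult_right_mono)
  \<comment> \<open>The ratio of the upper constant \<open>\<kappa> * J (b + 2)\<close> to the lower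
    constant \<open>J (- b) / \<kappa>\<close>.\<close>
  define C where "C = \<kappa>\<^sup>2 * J (b + 2) / J (- b)"
  have C0: "0 < C" using \<kappa> J0 by (simp add: C_def)
  show ?thesis
  proof (intro exI[of _ C] conjI C0 allI impI, elim conjE)
    fix \<sigma> :: real and F :: "real^'d \<Rightarrow> real"
    assume \<sigma>: "0 < \<sigma>" and F0': "\<forall>x. 0 \<le> F x" and F: "integrable lborel F"
      and Fm[measurable]: "F \<in> borel_measurable borel"
      and slow: "\<forall>x y. norm y \<le> \<sigma> \<longrightarrow> F (x - y) \<le> \<kappa> * F x"
    have F0: "\<And>x. 0 \<le> F x" using F0' by simp
    obtain Q :: "((real^'d) \<times> (real^'d \<Rightarrow> real)) measure" and \<zeta> \<phi> where
      Q: "cosine_mixture Q \<zeta> \<phi>" and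
      mix: "\<And>x. cosine_mixture.mix Q \<zeta> \<phi> x = (\<integral>y. F y * exp (- (norm ((x - y) /\<^sub>R \<sigma>))\<^sup>2 / 2) \<partial>lborel)"
      using gaussian_mixture_exists[OF \<sigma> F0 F Fm] by blast
    interpret cosine_mixture Q \<zeta> \<phi> by (rule Q)
    define S where "S = \<sigma> ^ DIM(real^'d)"
    have S: "0 < S" using \<sigma> by (simp add: S_def)
    \<comment> \<open>Substituting \<open>y = x - \<sigma> u\<close> puts the shift \<open>z\<close>
      on the smooth kernel and leaves \<open>F\<close> unshifted, so second differences never fall
      on \<open>F\<close>.\<close>
    have mix_add: "mix (x + z) = S * (\<integral>u. F (x - \<sigma> *\<^sub>R u) * k 0 (u + z /\<^sub>R \<sigma>) \<partial>lborel)" for x z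
    proof -
      have "mix (x + z) = \<bar>- \<sigma>\<bar> ^ DIM(real^'d) * (\<integral>u. F (x + (- \<sigma>) *\<^sub>R u) *
          exp (- (norm ((x + z - (x + (- \<sigma>) *\<^sub>R u)) /\<^sub>R \<sigma>))\<^sup>2 / 2) \<partial>lborel)"
        unfolding mix using \<sigma> by (intro lborel_integral_affine(1)) auto
      moreover have "(x + z - (x + (- \<sigma>) *\<^sub>R u)) /\<^sub>R \<sigma> = u + z /\<^sub>R \<sigma>" for u
        using \<sigma> by (simp add: scaleR_right_distrib scaleR_right_diff_distrib)
      ultimately show ?thesis using \<sigma> by (simp only:) (simp add: S_def k_def)
    qed
    have Fint: "integrable lborel (\<lambda>u. F (x - \<sigma> *\<^sub>R u))" for x
      using lborel_integral_affine(2)[OF Fm _ F, of "- \<sigma>" x] \<sigma> by simp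
    have Fkint: "integrable lborel (\<lambda>u. F (x - \<sigma> *\<^sub>R u) * k 0 (u + v))" for x v
      by (rule Bochner_Integration.integrable_bound[OF Fint[of x]])
        (auto simp: F0 k_def abs_mult intro!: mult_left_le)
    have up: "F (x - \<sigma> *\<^sub>R u) \<le> \<kappa> * exp (b * norm u) * F x" for x u
      using slow_variation_exp[where F=F and x=x and w="\<sigma> *\<^sub>R u", OF \<kappa> \<sigma> F0] slow \<sigma> by (simp add: b_def)
    have lo: "F x \<le> \<kappa> * exp (b * norm u) * F (x - \<sigma> *\<^sub>R u)" for x u
      using slow_variation_exp[where F=F and x="x - \<sigma> *\<^sub>R u" and w="- \<sigma> *\<^sub>R u", OF \<kappa> \<sigma> F0] slow \<sigma> by (simp add: b_def)
    have Fk_le: "F (x - \<sigma> *\<^sub>R u) * k c u \<le> \<kappa> * F x * k (b + c) u" for x u c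
    proof -
      have "F (x - \<sigma> *\<^sub>R u) * k c u \<le> \<kappa> * exp (b * norm u) * F x * k c u"
        using up k0[of c u] by (intro mult_right_mono) auto
      also have "\<dots> = \<kappa> * F x * (k c u * exp (b * norm u))" by (simp only: mult_ac)
      finally show ?thesis unfolding kk by (simp add: add.commute)
    qed
    have Fkint': "integrable lborel (\<lambda>u. F (x - \<sigma> *\<^sub>R u) * k c u)" for x c
      by (rule Bochner_Integration.integrable_bound[where f="\<lambda>u. \<kappa> * F x * k (b + c) u"])
        (use kint Fk_le F0 k0 \<kappa> in \<open>auto simp: abs_mult less_imp_le\<close>)
    have Fk_int_le: "(\<integral>u. F (x - \<sigma> *\<^sub>R u) * k c u \<partial>lborel) \<le> \<kappa> * F x * J (b + c)" for x c
    proof -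
      have "(\<integral>u. F (x - \<sigma> *\<^sub>R u) * k c u \<partial>lborel) \<le> (\<integral>u. \<kappa> * F x * k (b + c) u \<partial>lborel)"
        using Fkint' kint Fk_le by (intro integral_mono) auto
      thus ?thesis by (simp add: J_def)
    qed
    \<comment> \<open>Taking \<open>J (b + 2)\<close> instead of \<open>J b\<close> makes the same
      \<open>D\<close> bound both \<open>mix\<close> and the integral against \<open>k 2\<close> in
      the second difference.\<close>
    define D where "D = S * \<kappa> * J (b + 2)"
    have D: "0 < D" using S \<kappa> J0 by (simp add: D_def)
    have mix0: "mix x = S * (\<integral>u. F (x - \<sigma> *\<^sub>R u) * k 0 u \<partial>lborel)" for x
      using mix_add[of x 0] by simp
    have nonneg: "0 \<le> mix x" for x
      unfolding mix0 using S F0 k0 by (intro mult_nonneg_nonneg Bochner_Integration.integral_nonneg) (auto simp: less_imp_le)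
    have upper: "mix x \<le> D * F x" for x
    proof -
      have "mix x \<le> S * (\<kappa> * F x * J b)"
        unfolding mix0 using S Fk_int_le[of x 0] by (intro mult_left_mono) auto
      also have "\<dots> \<le> S * (\<kappa> * F x * J (b + 2))"
        using S \<kappa> F0 Jmono by (intro mult_left_mono) auto
      finally show ?thesis by (simp add: D_def mult_ac)
    qed
    have lower: "D * F x \<le> C * mix x" for x
    proof -
      have "F x * k (- b) u \<le> \<kappa> * (F (x - \<sigma> *\<^sub>R u) * k 0 u)" for u
      proof -
        have "F x * k (- b) u \<le> \<kappa> * exp (b * norm u) * F (x - \<sigma> *\<^sub>R u) * k (- b) u"
          using lo k0[of "-b" u] by (intro mult_right_mono) auto
        also have "\<dots> = \<kappa> * (F (x - \<sigma> *\<^sub>R u) * (k (- b) u * exp (b * norm u)))" by (simp only: mult_ac)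
        finally show ?thesis unfolding kk by simp
      qed
      hence "(\<integral>u. F x * k (- b) u \<partial>lborel) \<le> (\<integral>u. \<kappa> * (F (x - \<sigma> *\<^sub>R u) * k 0 u) \<partial>lborel)"
        using kint Fkint'[of x 0] by (intro integral_mono) auto
      hence "S * (F x * J (- b)) \<le> \<kappa> * mix x"
        using S mult_left_mono[of "F x * J (- b)" "\<kappa> * (\<integral>u. F (x - \<sigma> *\<^sub>R u) * k 0 u \<partial>lborel)" S]
        by (simp add: J_def mix0 mult_ac)
      hence "(\<kappa> * J (b + 2) / J (- b)) * (S * (F x * J (- b))) \<le> (\<kappa> * J (b + 2) / J (- b)) * (\<kappa> * mix x)"
        using \<kappa> J0 by (intro mult_left_mono) (auto simp: less_imp_le)
      thus ?thesis using J0[of "- b"] by (simp add: D_def C_def power2_eq_square mult_ac)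
    qed
    have diff: "\<bar>second_diff x z\<bar> \<le> C * (norm z / \<sigma>)\<^sup>2 * mix x" if z: "norm z \<le> \<sigma>" for x z
    proof -
      define v where "v = z /\<^sub>R \<sigma>"
      have v: "norm v \<le> 1" "norm v = norm z / \<sigma>" using z \<sigma> by (simp_all add: v_def field_simps)
      have m: "mix (x - z) = S * (\<integral>u. F (x - \<sigma> *\<^sub>R u) * k 0 (u - v) \<partial>lborel)"
        using mix_add[of x "- z"] by (simp add: v_def)
      have Fkint_m: "integrable lborel (\<lambda>u. F (x - \<sigma> *\<^sub>R u) * k 0 (u - v))"
        using Fkint[of x "- v"] by simp
      have "second_diff x z = - (S / 2) * ((\<integral>u. F (x - \<sigma> *\<^sub>R u) * k 0 (u + v) \<partial>lborel) + (\<integral>u. F (x - \<sigma> *\<^sub>R u) * k 0 (u - v) \<partial>lborel)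
          - 2 * (\<integral>u. F (x - \<sigma> *\<^sub>R u) * k 0 u \<partial>lborel))"
        unfolding second_diff_def m mix_add[of x z] mix0[of x] v_def[symmetric] by (simp add: algebra_simps)
      also have "\<dots> = - (S / 2) * (\<integral>u. F (x - \<sigma> *\<^sub>R u) * (k 0 (u + v) + k 0 (u - v) - 2 * k 0 u) \<partial>lborel)"
        using Fkint[of x v] Fkint_m Fkint[of x 0] by (simp add: distrib_left right_diff_distrib mult.left_commute[of _ 2])
      finally have "\<bar>second_diff x z\<bar> = S / 2 * \<bar>\<integral>u. F (x - \<sigma> *\<^sub>R u) * (k 0 (u + v) + k 0 (u - v) - 2 * k 0 u) \<partial>lborel\<bar>"
        using S by (simp add: abs_mult)
      also have "\<dots> \<le> S / 2 * (\<integral>u. 2 * (norm v)\<^sup>2 * (F (x - \<sigma> *\<^sub>R u) * k 2 u) \<partial>lborel)"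
      proof (intro mult_left_mono order_trans[OF integral_abs_bound] integral_mono)
        show "integrable lborel (\<lambda>u. \<bar>F (x - \<sigma> *\<^sub>R u) * (k 0 (u + v) + k 0 (u - v) - 2 * k 0 u)\<bar>)"
          using Fkint[of x v] Fkint_m Fkint[of x 0]
          by (intro integrable_abs) (simp add: distrib_left right_diff_distrib mult.left_commute[of _ 2])
        show "integrable lborel (\<lambda>u. 2 * (norm v)\<^sup>2 * (F (x - \<sigma> *\<^sub>R u) * k 2 u))"
          using Fkint' by auto
        show "\<bar>F (x - \<sigma> *\<^sub>R u) * (k 0 (u + v) + k 0 (u - v) - 2 * k 0 u)\<bar> \<le> 2 * (norm v)\<^sup>2 * (F (x - \<sigma> *\<^sub>R u) * k 2 u)" for u
        proof -
          have "\<bar>k 0 (u + v) + k 0 (u - v) - 2 * k 0 u\<bar> \<le> 2 * (norm v)\<^sup>2 * k 2 u"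
            using gaussian_second_difference[OF v(1), of u] by (simp add: k_def)
          from mult_left_mono[OF this F0[of "x - \<sigma> *\<^sub>R u"]] show ?thesis
            by (simp add: abs_mult F0 mult_ac)
        qed
      qed (use S in auto)
      also have "\<dots> = (norm v)\<^sup>2 * (S * (\<integral>u. F (x - \<sigma> *\<^sub>R u) * k 2 u \<partial>lborel))" by simp
      also have "\<dots> \<le> (norm v)\<^sup>2 * (S * (\<kappa> * F x * J (b + 2)))"
        using S Fk_int_le[of x 2] by (intro mult_left_mono) auto
      also have "\<dots> = (norm v)\<^sup>2 * (D * F x)" by (simp add: D_def mult_ac)
      also have "\<dots> \<le> (norm v)\<^sup>2 * (C * mix x)" using lower by (intro mult_left_mono) auto
      finally show ?thesis by (simp add: v(2) mult_ac)
    qed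
    show "\<exists>(Q :: ((real^'d) \<times> (real^'d \<Rightarrow> real)) measure) \<zeta> \<phi> D. cosine_mixture Q \<zeta> \<phi> \<and> 0 < D \<and>
      (\<forall>x. 0 \<le> cosine_mixture.mix Q \<zeta> \<phi> x \<and> cosine_mixture.mix Q \<zeta> \<phi> x \<le> D * F x \<and>
        D * F x \<le> C * cosine_mixture.mix Q \<zeta> \<phi> x) \<and>
      (\<forall>x z. norm z \<le> \<sigma> \<longrightarrow> \<bar>cosine_mixture.second_diff Q \<zeta> \<phi> x z\<bar> \<le> C * (norm z / \<sigma>)\<^sup>2 * cosine_mixture.mix Q \<zeta> \<phi> x)"
      using Q D nonneg upper lower diff by blast
  qed
qed

section \<open>Capped Levy densities\<close>

lemma K2_lessD:
  assumes "K2 \<nu> s1 s2 \<infinity> < ennreal \<kappa>" and pos: "\<And>z. z \<noteq> 0 \<Longrightarrow> 0 < \<nu> z" and s2: "0 < s2"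
    and "norm y \<le> s1" "s2 \<le> norm x"
  shows "\<nu> (x - y) \<le> \<kappa> * \<nu> x"
proof -
  obtain C where C: "1 \<le> C" "\<forall>x y. norm y \<le> s1 \<and> s2 \<le> norm x \<longrightarrow> \<nu> (x - y) \<le> C * \<nu> x" "ennreal C < ennreal \<kappa>"
    using assms(1) unfolding K2_def by (auto simp: INF_less_iff)
  have "C < \<kappa>" using C(1,3) by (simp add: ennreal_less_iff)
  moreover have "0 \<le> \<nu> x" using pos[of x] assms by fastforce
  ultimately show ?thesis using C(2) assms(4,5) by (meson less_imp_le mult_right_mono order_trans)
qed

lemma one_le_K2: "1 \<le> K2 \<nu> s1 s2 s3"
  unfolding K2_def by (intro INF_greatest) (auto simp flip: ennreal_1 intro: ennreal_leI)

lemma K1_leD: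
  assumes "K1 \<nu> s \<le> ennreal e" and "0 < \<nu> x" "s \<le> norm x" "0 \<le> e"
  shows "(\<integral>\<^sup>+y\<in>{y. s < norm (x - y) \<and> s < norm y}. ennreal (\<nu> (x - y) * \<nu> y) \<partial>lborel) \<le> ennreal (e * \<nu> x)"
    (is "?I \<le> _")
proof -
  have "ennreal (1 / \<nu> x) * ?I \<le> K1 \<nu> s"
    unfolding K1_def using assms(3) by (intro SUP_upper2[of x]) auto
  hence "ennreal (\<nu> x) * (ennreal (1 / \<nu> x) * ?I) \<le> ennreal (\<nu> x) * ennreal e"
    using assms(1) by (intro mult_left_mono) auto
  moreover have "ennreal (\<nu> x) * (ennreal (1 / \<nu> x) * ?I) = ?I"
    using assms(2) by (simp flip: mult.assoc ennreal_mult)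
  ultimately show ?thesis
    using assms(2,4) by (simp add: mult.commute flip: ennreal_mult)
qed

text \<open>As \<open>K2\<close> is at least 1, the product dominates
  \<open>K1 \<nu> (\<kappa>1 * s)\<close>; replacing \<open>s\<close> by
  \<open>s / \<kappa>1\<close> removes the dilation.\<close>

lemma K1_tendsto_0:
  assumes \<kappa>1: "2 \<le> \<kappa>1"
    and lim: "((\<lambda>s. K1 \<nu> (\<kappa>1 * s) * K2 \<nu> s (\<kappa>1 * s) \<infinity>) \<longlongrightarrow> 0) at_top"
  shows "(K1 \<nu> \<longlongrightarrow> 0) at_top"
proof -
  have "((\<lambda>s. K1 \<nu> (\<kappa>1 * s)) \<longlongrightarrow> 0) at_top"
  proof (rule tendsto_sandwich[OF _ _ tendsto_const lim])
    have "K1 \<nu> (\<kappa>1 * s) * 1 \<le> K1 \<nu> (\<kappa>1 * s) * K2 \<nu> s (\<kappa>1 * s) \<infinity>" for s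
      by (intro mult_left_mono one_le_K2) simp
    thus "\<forall>\<^sub>F s in at_top. K1 \<nu> (\<kappa>1 * s) \<le> K1 \<nu> (\<kappa>1 * s) * K2 \<nu> s (\<kappa>1 * s) \<infinity>" by simp
  qed simp
  moreover have "filterlim (\<lambda>s. s / \<kappa>1) at_top at_top"
    unfolding filterlim_at_top
  proof
    fix Z
    show "\<forall>\<^sub>F s in at_top. Z \<le> s / \<kappa>1"
      using eventually_ge_at_top[of "Z * \<kappa>1"] by eventually_elim (use \<kappa>1 in \<open>simp add: field_simps\<close>)
  qed
  ultimately have "((\<lambda>s. K1 \<nu> (\<kappa>1 * (s / \<kappa>1))) \<longlongrightarrow> 0) at_top"
    by (rule filterlim_compose)
  thus ?thesis using \<kappa>1 by simp
qed

text \<open>The value at the origin is fixed separately because \<open>\<nu> 0\<close> is arbitrary.\<close>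

definition capped :: "real \<Rightarrow> (real^'d \<Rightarrow> real) \<Rightarrow> real^'d \<Rightarrow> real" where
  "capped a \<nu> x = (if x = 0 then 1 else min 1 (a * \<nu> x))"

locale positive_density =
  fixes \<nu> :: "real^'d \<Rightarrow> real"
  assumes meas_\<nu>[measurable]: "\<nu> \<in> borel_measurable borel"
    and pos_\<nu>: "z \<noteq> 0 \<Longrightarrow> 0 < \<nu> z"
    and second_moment: "(\<integral>\<^sup>+z. ennreal ((norm z)\<^sup>2) \<partial>levy_meas_of \<nu>) < \<infinity>"
begin

lemma sets_levy[measurable_cong]: "sets (levy_meas_of \<nu>) = sets borel"
  by (simp add: levy_meas_of_def)

lemma sigma_finite_levy: "sigma_finite_measure (levy_meas_of \<nu>)"
proof -
  show ?thesis unfolding levy_meas_of_def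
    by (subst sigma_finite_measure.sigma_finite_iff_density_finite[OF lborel.sigma_finite_measure_axioms]) auto
qed

lemma integrable_norm_square: "integrable (levy_meas_of \<nu>) (\<lambda>z. (norm z)\<^sup>2)"
  using second_moment by (intro integrableI_bounded) auto

lemma nn_integral_levy:
  assumes [measurable]: "f \<in> borel_measurable borel"
  shows "(\<integral>\<^sup>+z. f z \<partial>levy_meas_of \<nu>) = (\<integral>\<^sup>+z. ennreal (\<nu> z) * f z \<partial>lborel)"
  unfolding levy_meas_of_def by (subst nn_integral_density) auto

text \<open>Chebyshev's inequality for the second moment.\<close>

lemma tail_le:
  assumes s: "0 < s"
  shows "emeasure (levy_meas_of \<nu>) {z. s < norm z} \<le> ennreal ((\<integral>z. (norm z)\<^sup>2 \<partial>levy_meas_of \<nu>) / s\<^sup>2)"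
proof -
  have "emeasure (levy_meas_of \<nu>) {z. s < norm z} = (\<integral>\<^sup>+z. indicator {z. s < norm z} z \<partial>levy_meas_of \<nu>)"
    by (rule nn_integral_indicator[symmetric]) (simp add: levy_meas_of_def)
  also have "\<dots> \<le> (\<integral>\<^sup>+z. ennreal ((norm z)\<^sup>2 / s\<^sup>2) \<partial>levy_meas_of \<nu>)"
  proof (intro nn_integral_mono)
    fix z :: "real^'d"
    have "s < norm z \<Longrightarrow> 1 \<le> (norm z)\<^sup>2 / s\<^sup>2" using s by (simp add: power_mono)
    thus "indicator {z. s < norm z} z \<le> ennreal ((norm z)\<^sup>2 / s\<^sup>2)"
      by (auto simp: indicator_def simp flip: ennreal_1 intro: ennreal_leI)
  qed
  also have "\<dots> = ennreal (\<integral>z. (norm z)\<^sup>2 / s\<^sup>2 \<partial>levy_meas_of \<nu>)"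
    using integrable_norm_square by (intro nn_integral_eq_integral) auto
  finally show ?thesis by simp
qed

lemma capped_measurable[measurable]: "capped a \<nu> \<in> borel_measurable borel"
  unfolding capped_def[abs_def] by measurable

lemma capped_bounds:
  assumes "0 < a"
  shows "0 < capped a \<nu> x" "capped a \<nu> x \<le> 1" "x \<noteq> 0 \<Longrightarrow> capped a \<nu> x \<le> a * \<nu> x"
  using assms pos_\<nu>[of x] by (auto simp: capped_def)

text \<open>The cap controls the unit ball; outside it \<open>(norm z)\<^sup>2\<close> exceeds 1 and
  the second moment takes over.\<close>

lemma capped_integrable:
  assumes a: "0 < a"
  shows "integrable lborel (capped a \<nu>)"
proof (rule Bochner_Integration.integrable_bound)
  have nn: "(\<integral>\<^sup>+z. ennreal (\<nu> z * (norm z)\<^sup>2) \<partial>lborel) < \<infinity>"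
    using second_moment by (simp add: nn_integral_levy ennreal_mult'')
  have nz: "0 \<le> \<nu> z * (norm z)\<^sup>2" for z using pos_\<nu>[of z] by (cases "z = 0") auto
  have "integrable lborel (\<lambda>z. \<nu> z * (norm z)\<^sup>2)"
    using nn nz by (intro integrableI_bounded) auto
  thus "integrable lborel (\<lambda>z. indicator (cball 0 1) z + a * (\<nu> z * (norm z)\<^sup>2))"
    by (intro Bochner_Integration.integrable_add integrable_mult_right)
      (auto simp: integrable_indicator_iff emeasure_cball)
  have "capped a \<nu> z \<le> indicator (cball 0 1) z + a * (\<nu> z * (norm z)\<^sup>2)" for z
  proof (cases "norm z \<le> 1")
    case True
    thus ?thesis using capped_bounds(2)[OF a, of z] nz[of z] a by (simp add: add_increasing2)
  next
    case False
    hence "z \<noteq> 0" by auto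
    hence "0 < \<nu> z" by (rule pos_\<nu>)
    hence "\<nu> z * 1 \<le> \<nu> z * (norm z)\<^sup>2" using False by (intro mult_left_mono) (auto simp: one_le_power)
    hence "a * \<nu> z \<le> a * (\<nu> z * (norm z)\<^sup>2)" using a by simp
    thus ?thesis using capped_bounds(3)[OF a \<open>z \<noteq> 0\<close>] False by simp
  qed
  thus "AE z in lborel. norm (capped a \<nu> z) \<le> norm (indicator (cball 0 1) z + a * (\<nu> z * (norm z)\<^sup>2) :: real)"
    using capped_bounds(1)[OF a] by (intro AE_I2) (smt (verit) real_norm_def)
qed simp

text \<open>Outside radius \<open>S\<close> the density varies by at most \<open>\<kappa>\<close> at
  scale \<open>\<sigma>\<close>. Inside, where no such control is available, \<open>a\<close> is
  large enough for the cap to make the function constant.\<close>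

context
  fixes \<kappa> \<sigma> S a :: real
  assumes \<kappa>: "1 \<le> \<kappa>" and \<sigma>: "0 < \<sigma>" "\<sigma> < S" and a: "0 < a"
    and slow: "\<And>x y. norm y \<le> \<sigma> \<Longrightarrow> S \<le> norm x \<Longrightarrow> \<nu> (x - y) \<le> \<kappa> * \<nu> x"
    and cap: "\<And>x. x \<noteq> 0 \<Longrightarrow> norm x \<le> S \<Longrightarrow> 1 \<le> a * \<nu> x"
begin

lemma capped_eq_1: "norm x \<le> S \<Longrightarrow> capped a \<nu> x = 1"
  using cap[of x] by (simp add: capped_def)

text \<open>Inside radius \<open>S\<close> the value at \<open>x\<close> is already the maximum.
  Outside, the estimate for \<open>\<nu>\<close> survives the minimum with 1 because
  \<open>\<kappa>\<close> is at least 1, and \<open>\<sigma> < S\<close> keeps \<open>x - y\<close>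
  away from 0.\<close>

lemma capped_slow:
  assumes y: "norm y \<le> \<sigma>"
  shows "capped a \<nu> (x - y) \<le> \<kappa> * capped a \<nu> x"
proof (cases "norm x \<le> S")
  case True
  have "capped a \<nu> (x - y) \<le> 1" by (rule capped_bounds(2)[OF a])
  thus ?thesis using capped_eq_1[OF True] \<kappa> by simp
next
  case False
  hence "x \<noteq> 0" "x - y \<noteq> 0" using \<sigma> y by auto
  moreover have "a * \<nu> (x - y) \<le> \<kappa> * (a * \<nu> x)"
    using slow[OF y, of x] False a by (simp add: mult.left_commute[of \<kappa>])
  ultimately show ?thesis using \<kappa> by (auto simp: capped_def min_def)
qed

text \<open>Where the cap is attained at \<open>x\<close>, the tail of the Levy measure suffices.
  Elsewhere the integral is split by the landing point \<open>x - z\<close>. If it is farther than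
  \<open>s\<close> from 0, \<open>K1\<close> controls the convolution of \<open>\<nu>\<close> with
  itself. Otherwise \<open>z\<close> is within \<open>s\<close> of \<open>x\<close>, so
  \<open>\<nu> z\<close> is at most \<open>\<kappa> * \<nu> x\<close>, and the ball volume is
  absorbed by the size of \<open>a\<close>.\<close>

lemma capped_jumps:
  assumes s: "0 < s" "s \<le> \<sigma>" and e: "0 < e"
    and tail: "emeasure (levy_meas_of \<nu>) {z. s < norm z} \<le> ennreal e"
    and K: "K1 \<nu> s \<le> ennreal e"
    and vol: "\<kappa> * (unit_ball_vol (real CARD('d)) * s ^ CARD('d)) \<le> a * e"
  shows "(\<integral>\<^sup>+z\<in>{z. s < norm z}. ennreal (capped a \<nu> (x - z)) \<partial>levy_meas_of \<nu>) \<le> ennreal (2 * e * capped a \<nu> x)"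
proof (cases "capped a \<nu> x = 1")
  case True
  have "(\<integral>\<^sup>+z\<in>{z. s < norm z}. ennreal (capped a \<nu> (x - z)) \<partial>levy_meas_of \<nu>)
      \<le> (\<integral>\<^sup>+z. indicator {z. s < norm z} z \<partial>levy_meas_of \<nu>)"
    using capped_bounds(2)[OF a] by (intro nn_integral_mono) (auto simp: indicator_def)
  also have "\<dots> = emeasure (levy_meas_of \<nu>) {z. s < norm z}"
    by (rule nn_integral_indicator) (simp add: levy_meas_of_def)
  also have "\<dots> \<le> ennreal (2 * e * capped a \<nu> x)"
    using tail e True by (auto elim!: order_trans intro: ennreal_leI)
  finally show ?thesis .
next
  case False
  hence nS: "S < norm x" using capped_eq_1[of x] by fastforce
  hence x0: "x \<noteq> 0" and sx: "s \<le> norm x" using \<sigma> s by auto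
  have cx: "capped a \<nu> x = a * \<nu> x" using False x0 by (auto simp: capped_def min_def split: if_splits)
  have \<nu>x: "0 < \<nu> x" using pos_\<nu> x0 by simp
  have [measurable]: "cball x s \<in> sets borel" by simp
  let ?I = "\<lambda>z. indicator {z. s < norm (x - z) \<and> s < norm z} z :: ennreal"
  have "(\<integral>\<^sup>+z\<in>{z. s < norm z}. ennreal (capped a \<nu> (x - z)) \<partial>levy_meas_of \<nu>)
     = (\<integral>\<^sup>+z. ennreal (\<nu> z) * (ennreal (capped a \<nu> (x - z)) * indicator {z. s < norm z} z) \<partial>lborel)"
    by (rule nn_integral_levy) measurable
  also have "\<dots> \<le> (\<integral>\<^sup>+z. ennreal a * (ennreal (\<nu> (x - z) * \<nu> z) * ?I z) + ennreal (\<kappa> * \<nu> x) * indicator (cball x s) z \<partial>lborel)"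
  proof (intro nn_integral_mono)
    fix z
    show "ennreal (\<nu> z) * (ennreal (capped a \<nu> (x - z)) * indicator {z. s < norm z} z)
       \<le> ennreal a * (ennreal (\<nu> (x - z) * \<nu> z) * ?I z) + ennreal (\<kappa> * \<nu> x) * indicator (cball x s) z"
    proof (cases "s < norm z")
      case z: True
      hence "z \<noteq> 0" using s by auto
      hence \<nu>z: "0 < \<nu> z" by (rule pos_\<nu>)
      show ?thesis
      proof (cases "s < norm (x - z)")
        case True
        hence "x - z \<noteq> 0" using s by auto
        hence "\<nu> z * capped a \<nu> (x - z) \<le> \<nu> z * (a * \<nu> (x - z))"
          using capped_bounds(3)[OF a] \<nu>z by (intro mult_left_mono) auto
        hence "ennreal (\<nu> z) * ennreal (capped a \<nu> (x - z)) \<le> ennreal a * ennreal (\<nu> (x - z) * \<nu> z)"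
          using \<nu>z a capped_bounds(1)[OF a, of "x - z"] pos_\<nu>[OF \<open>x - z \<noteq> 0\<close>]
          by (simp add: mult_ac less_imp_le flip: ennreal_mult)
        thus ?thesis using True z by (simp add: add_increasing2)
      next
        case False
        hence "\<nu> (x - (x - z)) \<le> \<kappa> * \<nu> x" using s nS by (intro slow) auto
        moreover have "\<nu> z * capped a \<nu> (x - z) \<le> \<nu> z * 1"
          using capped_bounds(2)[OF a] \<nu>z by (intro mult_left_mono) auto
        ultimately have "\<nu> z * capped a \<nu> (x - z) \<le> \<kappa> * \<nu> x" by (simp only: mult_1_right diff_diff_eq2 add_diff_cancel_left')
        hence "ennreal (\<nu> z) * ennreal (capped a \<nu> (x - z)) \<le> ennreal (\<kappa> * \<nu> x)"
          using \<nu>z capped_bounds(1)[OF a, of "x - z"] by (simp add: ennreal_leI flip: ennreal_mult)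
        thus ?thesis using False z by (simp add: add_increasing dist_norm)
      qed
    qed simp
  qed
  also have "\<dots> = ennreal a * (\<integral>\<^sup>+z. ennreal (\<nu> (x - z) * \<nu> z) * ?I z \<partial>lborel)
      + ennreal (\<kappa> * \<nu> x) * emeasure lborel (cball x s)"
    by (subst nn_integral_add) (auto simp: nn_integral_cmult)
  also have "\<dots> \<le> ennreal a * ennreal (e * \<nu> x) + ennreal (\<kappa> * \<nu> x) * ennreal (unit_ball_vol (real CARD('d)) * s ^ CARD('d))"
    using K1_leD[OF K \<nu>x sx] e s by (intro add_mono mult_left_mono) (auto simp: emeasure_cball)
  also have "\<dots> = ennreal (a * (e * \<nu> x) + \<nu> x * (\<kappa> * (unit_ball_vol (real CARD('d)) * s ^ CARD('d))))"
    using a e \<nu>x s \<kappa> by (simp add: mult_ac flip: ennreal_mult ennreal_plus)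
  also have "\<dots> \<le> ennreal (a * (e * \<nu> x) + \<nu> x * (a * e))"
    using vol \<nu>x by (intro ennreal_leI add_left_mono mult_left_mono) auto
  also have "a * (e * \<nu> x) + \<nu> x * (a * e) = 2 * e * capped a \<nu> x" by (simp add: cx)
  finally show ?thesis .
qed

end

end

section \<open>From pointwise estimates on the mixture to the supermartingale property\<close>

lemma char_exponent_nonneg:
  assumes "\<And>\<xi>. 0 \<le> (A *v \<xi>) \<bullet> \<xi>"
  shows "0 \<le> char_exponent A N \<xi>"
  unfolding char_exponent_def
  using assms by (intro add_nonneg_nonneg Bochner_Integration.integral_nonneg) auto

text \<open>All error terms are proportional to \<open>mix x\<close>, so the condition on
  \<open>\<eta>\<close> makes their sum at most \<open>\<eta> * mix x\<close>, which is the
  hypothesis of \<open>mix_supermartingale\<close>. Boundedness of \<open>mix\<close> permits the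
  passage to the nonnegative integral.\<close>

lemma levy_mix_supermartingale:
  fixes X :: "real \<Rightarrow> 'w \<Rightarrow> real^'d" and \<nu> :: "real^'d \<Rightarrow> real"
  assumes CM: "cosine_mixture Q \<zeta> \<phi>" and PD: "positive_density \<nu>"
    and X: "symmetric_levy_process M X A (levy_meas_of \<nu>)"
    and nonneg: "\<And>x. 0 \<le> cosine_mixture.mix Q \<zeta> \<phi> x"
    and s: "0 < s" and c: "0 \<le> c" and T: "0 \<le> T"
    and diff: "\<And>x z. norm z \<le> s \<Longrightarrow>
      \<bar>cosine_mixture.second_diff Q \<zeta> \<phi> x z\<bar> \<le> c * cosine_mixture.mix Q \<zeta> \<phi> x * (norm z)\<^sup>2"
    and jumps: "\<And>x. (\<integral>\<^sup>+z\<in>{z. s < norm z}. ennreal (cosine_mixture.mix Q \<zeta> \<phi> (x - z)) \<partial>levy_meas_of \<nu>)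
      \<le> ennreal (T * cosine_mixture.mix Q \<zeta> \<phi> x)"
    and \<eta>: "c * (4 * (\<Sum>i\<in>UNIV. \<Sum>j\<in>UNIV. \<bar>A $ i $ j\<bar>) + (\<integral>z. (norm z)\<^sup>2 \<partial>levy_meas_of \<nu>)) + T \<le> \<eta>" "0 \<le> \<eta>"
    and t: "0 \<le> t"
  shows "(\<integral>\<^sup>+w. ennreal (cosine_mixture.mix Q \<zeta> \<phi> (x + X t w)) \<partial>M) \<le> ennreal (exp (\<eta> * t) * cosine_mixture.mix Q \<zeta> \<phi> x)"
proof -
  interpret cosine_mixture Q \<zeta> \<phi> by fact
  interpret positive_density \<nu> by fact
  let ?N = "levy_meas_of \<nu>" and ?B = "4 * (\<Sum>i\<in>UNIV. \<Sum>j\<in>UNIV. \<bar>A $ i $ j\<bar>) + (\<integral>z. (norm z)\<^sup>2 \<partial>levy_meas_of \<nu>)"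
  note N = sigma_finite_levy sets_levy integrable_norm_square
  have M: "prob_space M" and Xm: "\<And>t. 0 \<le> t \<Longrightarrow> X t \<in> borel_measurable M"
    and psd: "\<And>\<xi>. 0 \<le> (A *v \<xi>) \<bullet> \<xi>" and sym: "symmetric_measure ?N"
    and ch: "\<And>t \<xi>. 0 \<le> t \<Longrightarrow> (\<integral>w. iexp (\<xi> \<bullet> X t w) \<partial>M) = complex_of_real (exp (- t * char_exponent A ?N \<xi>))"
    using X by (auto simp: symmetric_levy_process_def levy_process_def)
  interpret M: prob_space M by fact
  note [measurable] = Xm[OF t]
  have "(\<integral>w. mix (x + X t w) \<partial>M) \<le> exp (\<eta> * t) * mix x"
  proof (rule mix_supermartingale[OF M Xm ch integrable_exponent(1)[OF N] char_exponent_nonneg[OF psd]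
        integrable_exponent(2)[OF N] \<eta>(2) _ t])
    fix x
    have "- (c * mix x * ?B + T * mix x) \<le> (\<integral>q. char_exponent A ?N (\<zeta> q) * cos (\<zeta> q \<bullet> x - \<phi> q) \<partial>Q)"
      using nonneg c T diff
      by (intro exponent_integral_lower[OF N sym nonneg s _ _ jumps] mult_nonneg_nonneg) auto
    moreover have "(c * ?B + T) * mix x \<le> \<eta> * mix x"
      using \<eta>(1) nonneg by (intro mult_right_mono)
    ultimately show "0 \<le> \<eta> * mix x + (\<integral>q. char_exponent A ?N (\<zeta> q) * cos (\<zeta> q \<bullet> x - \<phi> q) \<partial>Q)"
      by (simp add: algebra_simps)
  qed
  moreover have "integrable M (\<lambda>w. mix (x + X t w))"
    using mix_bounded by (intro M.integrable_const_bound[where B="measure Q (space Q)"]) auto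
  ultimately show ?thesis
    using nonneg by (subst nn_integral_eq_integral) (auto intro: ennreal_leI)
qed

section \<open>Choice of the constants and conclusion\<close>

theorem theorem3p3:
  fixes M :: "'w measure"
    and X :: "real \<Rightarrow> 'w \<Rightarrow> real^'d"
    and A :: "real^'d^'d"
    and \<nu> :: "real^'d \<Rightarrow> real"
    and p :: "real \<Rightarrow> real^'d \<Rightarrow> ennreal"
  assumes "symmetric_jump_paring_levy_process M X A \<nu> p"
    and "\<exists>C9::real. \<forall>t>0. \<forall>r\<ge>1.
           (SUP x\<in>{x. r \<le> norm x}. p t x)
             \<le> ennreal (C9 * t * max_exponent A (levy_meas_of \<nu>) (1 / r) * r powr (- real CARD('d)))"
    and "(\<integral>\<^sup>+z. ennreal ((norm z)\<^sup>2) \<partial>levy_meas_of \<nu>) < \<infinity>"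
    and "\<exists>C17\<ge>1::real. \<exists>R0>0::real. \<forall>t>0. \<forall>x y.
           norm y \<le> norm x \<and> R0 \<le> norm y \<and> norm (x - y) \<le> 1 \<longrightarrow> p t x \<le> ennreal C17 * p t y"
    and "\<exists>\<kappa>1\<ge>2::real. ((\<lambda>s. K1 \<nu> (\<kappa>1 * s) * K2 \<nu> s (\<kappa>1 * s) \<infinity>) \<longlongrightarrow> 0) at_top"
    and "\<exists>\<kappa>2::real. \<forall>s1\<ge>1. Limsup at_top (\<lambda>s. K2 \<nu> s1 s \<infinity>) \<le> ennreal \<kappa>2"
  shows "\<forall>\<eta>>0. \<forall>r>0. \<exists>C19 R. r < R \<and>
           (\<forall>x. R \<le> norm x \<longrightarrow>
              exit_laplace M X (- cball 0 r) \<eta> x \<le> ennreal (C19 * \<nu> x))"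
proof (intro allI impI)
  fix \<eta> r :: real
  assume \<eta>: "0 < \<eta>" and r: "0 < r"
  have X: "symmetric_levy_process M X A (levy_meas_of \<nu>)" and L: "levy_process M X"
    and \<nu>: "\<nu> \<in> borel_measurable borel" "\<And>z. z \<noteq> 0 \<Longrightarrow> 0 < \<nu> z"
    using assms(1) by (auto simp: symmetric_jump_paring_levy_process_def symmetric_levy_process_def
      infinite_positive_density_def)
  interpret positive_density \<nu>
    using \<nu> assms(3) by unfold_locales
  obtain g :: "real \<Rightarrow> real" and C5 where g0: "\<And>s. 0 < s \<Longrightarrow> 0 < g s"
    and g_mono: "\<And>s t. 0 < s \<Longrightarrow> s \<le> t \<Longrightarrow> g t \<le> g s" and C5: "1 \<le> C5"
    and g_le: "\<And>x. x \<noteq> 0 \<Longrightarrow> inverse C5 * g (norm x) \<le> \<nu> x"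
  proof -
    have "jump_paring_density \<nu>" using assms(1) by (simp add: symmetric_jump_paring_levy_process_def)
    then obtain g C5 where "\<forall>s>0. 0 < g s" "\<forall>s t. 0 < s \<and> s \<le> t \<longrightarrow> g t \<le> g s" "1 \<le> C5"
      "\<forall>x. x \<noteq> 0 \<longrightarrow> inverse C5 * g (norm x) \<le> \<nu> x \<and> \<nu> x \<le> C5 * g (norm x)"
      unfolding jump_paring_density_def by blast
    thus ?thesis using that[of g C5] by blast
  qed
  obtain \<kappa>2 where \<kappa>2: "\<And>s1. 1 \<le> s1 \<Longrightarrow> Limsup at_top (\<lambda>s. K2 \<nu> s1 s \<infinity>) \<le> ennreal \<kappa>2"
    using assms(6) by blast
  \<comment> \<open>Strictly above \<open>\<kappa>2\<close>, so that the bound on the upper limit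
    becomes an eventual bound at every scale \<open>\<sigma> \<ge> 1\<close>; the maximum covers a
    small or negative \<open>\<kappa>2\<close>.\<close>
  define \<kappa> where "\<kappa> = max \<kappa>2 1 + 1"
  have \<kappa>: "1 \<le> \<kappa>" "ennreal \<kappa>2 < ennreal \<kappa>"
    by (simp add: \<kappa>_def, rule ennreal_lessI) (auto simp: \<kappa>_def)
  obtain C where C: "0 < C" and mixture: "\<And>\<sigma> F :: real^'d \<Rightarrow> real. 0 < \<sigma> \<Longrightarrow>
    (\<forall>x. 0 \<le> F x) \<and> integrable lborel F \<and> F \<in> borel_measurable borel \<and>
    (\<forall>x y. norm y \<le> \<sigma> \<longrightarrow> F (x - y) \<le> \<kappa> * F x) \<Longrightarrow>
    (\<exists>(Q :: ((real^'d) \<times> (real^'d \<Rightarrow> real)) measure) \<zeta> \<phi> D. cosine_mixture Q \<zeta> \<phi> \<and> 0 < D \<and>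
      (\<forall>x. 0 \<le> cosine_mixture.mix Q \<zeta> \<phi> x \<and> cosine_mixture.mix Q \<zeta> \<phi> x \<le> D * F x \<and>
        D * F x \<le> C * cosine_mixture.mix Q \<zeta> \<phi> x) \<and>
      (\<forall>x z. norm z \<le> \<sigma> \<longrightarrow> \<bar>cosine_mixture.second_diff Q \<zeta> \<phi> x z\<bar> \<le> C * (norm z / \<sigma>)\<^sup>2 * cosine_mixture.mix Q \<zeta> \<phi> x))"
    using slowly_varying_mixture[OF \<kappa>(1), where 'd='d] by (elim exE conjE) (rule that; blast)
  define m where "m = (\<integral>z. (norm z)\<^sup>2 \<partial>levy_meas_of \<nu>)"
  define B where "B = 4 * (\<Sum>i\<in>UNIV. \<Sum>j\<in>UNIV. \<bar>A $ i $ j\<bar>) + m"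
  have m0: "0 \<le> m" by (simp add: m_def)
  have B0: "0 \<le> B" using m0 by (simp add: B_def sum_nonneg)
  \<comment> \<open>Large jumps will cost \<open>2 * e * C\<close>, which is half of
    \<open>\<eta>\<close>. This fixes \<open>s\<close> through the tail and
    \<open>K1\<close>.\<close>
  define e where "e = \<eta> / (4 * C)"
  have e: "0 < e" using \<eta> C by (simp add: e_def)
  have "\<forall>\<^sub>F s in at_top. K1 \<nu> s < ennreal e"
  proof -
    have "(K1 \<nu> \<longlongrightarrow> 0) at_top" using assms(5) K1_tendsto_0 by blast
    thus ?thesis by (rule order_tendstoD) (use e in simp)
  qed
  hence "\<forall>\<^sub>F s in at_top. K1 \<nu> s < ennreal e \<and> max 1 (m / e) \<le> s"
    by (rule eventually_conj) (rule eventually_ge_at_top)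
  then obtain s where s1: "1 \<le> s" "m / e \<le> s" and K: "K1 \<nu> s \<le> ennreal e"
    by (auto dest!: eventually_happens simp: less_imp_le)
  have tail: "emeasure (levy_meas_of \<nu>) {z. s < norm z} \<le> ennreal e"
  proof -
    have "m \<le> e * s" using s1 e by (simp add: field_simps)
    also have "\<dots> \<le> e * s\<^sup>2" using s1 e by (simp add: power2_eq_square)
    finally have "m / s\<^sup>2 \<le> e" using s1 by (simp add: field_simps)
    thus ?thesis using tail_le[of s] s1 by (auto simp: m_def elim!: order_trans intro: ennreal_leI)
  qed
  \<comment> \<open>The second summand keeps the cost \<open>C * B / \<sigma>\<^sup>2\<close> of
    diffusion and small jumps below the other half of \<open>\<eta>\<close>; the first gives
    \<open>s \<le> \<sigma>\<close>.\<close>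
  define \<sigma> where "\<sigma> = s + 2 * C * B / \<eta>"
  have "0 \<le> 2 * C * B / \<eta>" using C B0 \<eta> by simp
  hence \<sigma>: "s \<le> \<sigma>" "1 \<le> \<sigma>" "0 < \<sigma>" "2 * C * B / \<eta> \<le> \<sigma>" using s1 unfolding \<sigma>_def by linarith+
  have cB: "C / \<sigma>\<^sup>2 * B \<le> \<eta> / 2"
  proof -
    have "2 * (C * B) \<le> \<eta> * \<sigma>" using \<sigma>(4) \<eta> by (simp add: field_simps)
    also have "\<dots> \<le> \<eta> * \<sigma>\<^sup>2" using \<sigma> \<eta> by (simp add: power2_eq_square)
    finally show ?thesis using \<sigma> by (simp add: field_simps)
  qed
  \<comment> \<open>The radius \<open>S\<close> may depend on \<open>\<sigma>\<close>, since
    \<open>\<kappa>\<close> and hence \<open>C\<close> do not. The bound \<open>2 * r\<close> makes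
    room for a neighbourhood of the target ball.\<close>
  have "\<forall>\<^sub>F S in at_top. K2 \<nu> \<sigma> S \<infinity> < ennreal \<kappa>"
    using \<kappa>2[OF \<sigma>(2)] \<kappa>(2) by (intro Limsup_lessD) simp
  hence "\<forall>\<^sub>F S in at_top. K2 \<nu> \<sigma> S \<infinity> < ennreal \<kappa> \<and> max (\<sigma> + 1) (2 * r) \<le> S"
    by (rule eventually_conj) (rule eventually_ge_at_top)
  then obtain S where S': "max (\<sigma> + 1) (2 * r) \<le> S" and K2S: "K2 \<nu> \<sigma> S \<infinity> < ennreal \<kappa>"
    by (auto dest!: eventually_happens)
  have S: "\<sigma> < S" "2 * r \<le> S" using S' by simp_all
  have S0: "0 < S" using S \<sigma> by simp
  have slow: "\<nu> (x - y) \<le> \<kappa> * \<nu> x" if "norm y \<le> \<sigma>" "S \<le> norm x" for x y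
    using K2_lessD[OF K2S \<nu>(2) S0 that] .
  define vol where "vol = \<kappa> * (unit_ball_vol (real CARD('d)) * s ^ CARD('d))"
  \<comment> \<open>The first entry keeps the cap active up to radius \<open>S\<close>, by
    monotonicity of \<open>g\<close>; the second absorbs the volume term of
    \<open>capped_jumps\<close>.\<close>
  define a where "a = max (C5 / g S) (vol / e)"
  have a0: "0 < a" using C5 g0[OF S0] by (simp add: a_def less_max_iff_disj)
  have vol: "vol \<le> a * e"
    using e by (simp add: a_def pos_divide_le_eq[symmetric])
  have cap: "1 \<le> a * \<nu> x" if x: "x \<noteq> 0" "norm x \<le> S" for x
  proof -
    have "C5 / g S \<le> a" by (simp add: a_def)
    have "1 = C5 / g S * (inverse C5 * g S)" using C5 g0[OF S0] by simp
    also have "\<dots> \<le> a * (inverse C5 * g (norm x))"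
      using \<open>C5 / g S \<le> a\<close> C5 g0[OF S0] g_mono[of "norm x" S] x a0 by (intro mult_mono) auto
    also have "\<dots> \<le> a * \<nu> x" using g_le x a0 by (intro mult_left_mono) auto
    finally show ?thesis .
  qed
  note capped = \<kappa>(1) \<sigma>(3) S(1) a0 slow cap
  define F where "F = capped a \<nu>"
  have F_slow: "F (x - y) \<le> \<kappa> * F x" if "norm y \<le> \<sigma>" for x y
    unfolding F_def by (rule capped_slow[OF capped that])
  have F_jumps: "(\<integral>\<^sup>+z\<in>{z. s < norm z}. ennreal (F (x - z)) \<partial>levy_meas_of \<nu>) \<le> ennreal (2 * e * F x)" for x
    unfolding F_def using s1 by (intro capped_jumps[OF capped _ \<sigma>(1) e tail K] vol[unfolded vol_def]) auto
  have F_1: "F x = 1" if "norm x \<le> S" for x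
    unfolding F_def by (rule capped_eq_1[OF capped that])
  have F0: "0 < F x" for x using capped_bounds[OF a0] by (simp add: F_def)
  have [measurable]: "F \<in> borel_measurable borel" by (simp add: F_def)
  obtain Q :: "((real^'d) \<times> (real^'d \<Rightarrow> real)) measure" and \<zeta> \<phi> D where CM: "cosine_mixture Q \<zeta> \<phi>" and D: "0 < D"
    and nonneg: "\<And>x. 0 \<le> cosine_mixture.mix Q \<zeta> \<phi> x"
    and upper: "\<And>x. cosine_mixture.mix Q \<zeta> \<phi> x \<le> D * F x"
    and lower: "\<And>x. D * F x \<le> C * cosine_mixture.mix Q \<zeta> \<phi> x"
    and diff: "\<And>x z. norm z \<le> \<sigma> \<Longrightarrow> \<bar>cosine_mixture.second_diff Q \<zeta> \<phi> x z\<bar> \<le> C * (norm z / \<sigma>)\<^sup>2 * cosine_mixture.mix Q \<zeta> \<phi> x"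
    using mixture[OF \<sigma>(3), of F] F0 F_slow capped_integrable[OF a0]
    by (auto simp: F_def less_imp_le)
  interpret cosine_mixture Q \<zeta> \<phi> by (rule CM)
  have super: "(\<integral>\<^sup>+w. ennreal (mix (y + X t w)) \<partial>M) \<le> ennreal (exp (\<eta> * t) * mix y)" if t: "0 \<le> t" for t y
  proof (rule levy_mix_supermartingale[OF CM positive_density_axioms X nonneg, where s=s and c="C / \<sigma>\<^sup>2" and T="2 * e * C"])
    show "\<bar>second_diff x z\<bar> \<le> C / \<sigma>\<^sup>2 * mix x * (norm z)\<^sup>2" if "norm z \<le> s" for x z
      using diff[of z x] that \<sigma>(1) by (simp add: power_divide mult_ac)
    show "(\<integral>\<^sup>+z\<in>{z. s < norm z}. ennreal (mix (x - z)) \<partial>levy_meas_of \<nu>) \<le> ennreal (2 * e * C * mix x)" for x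
    proof -
      have "(\<integral>\<^sup>+z\<in>{z. s < norm z}. ennreal (mix (x - z)) \<partial>levy_meas_of \<nu>)
        \<le> (\<integral>\<^sup>+z. ennreal D * (ennreal (F (x - z)) * indicator {z. s < norm z} z) \<partial>levy_meas_of \<nu>)"
        using upper D F0
        by (intro nn_integral_mono) (auto simp: indicator_def less_imp_le ennreal_leI simp flip: ennreal_mult)
      also have "\<dots> = ennreal D * (\<integral>\<^sup>+z\<in>{z. s < norm z}. ennreal (F (x - z)) \<partial>levy_meas_of \<nu>)"
        by (rule nn_integral_cmult) measurable
      also have "\<dots> \<le> ennreal D * ennreal (2 * e * F x)" by (intro mult_left_mono F_jumps) simp
      also have "\<dots> = ennreal (2 * e * (D * F x))" using D e F0[of x] by (simp add: mult_ac less_imp_le flip: ennreal_mult)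
      also have "\<dots> \<le> ennreal (2 * e * (C * mix x))" using lower e by (intro ennreal_leI mult_left_mono) auto
      finally show ?thesis by (simp add: mult_ac)
    qed
    have "2 * e * C = \<eta> / 2" using C by (simp add: e_def)
    thus "C / \<sigma>\<^sup>2 * (4 * (\<Sum>i\<in>UNIV. \<Sum>j\<in>UNIV. \<bar>A $ i $ j\<bar>) + (\<integral>z. (norm z)\<^sup>2 \<partial>levy_meas_of \<nu>)) + 2 * e * C \<le> \<eta>"
      using cB unfolding B_def m_def by linarith
  qed (use s1 C e \<eta> t in auto)
  \<comment> \<open>By \<open>lower\<close> this normalization puts \<open>H\<close> above
    \<open>F\<close>, hence above 1 wherever the cap is active.\<close>
  define H where "H y = ennreal (C / D * mix y)" for y
  have Hm: "H \<in> borel_measurable borel" unfolding H_def by measurable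
  have bound: "exit_laplace M X (- cball 0 r) \<eta> x \<le> H x" for x
  proof (rule exit_laplace_le_supermartingale[OF L Hm, where U="ball 0 (2 * r)"])
    fix t :: real and y
    assume t: "0 \<le> t"
    have "(\<integral>\<^sup>+w. H (y + X t w) \<partial>M) = ennreal (C / D) * (\<integral>\<^sup>+w. ennreal (mix (y + X t w)) \<partial>M)"
    proof -
      have [measurable]: "X t \<in> borel_measurable M" using L t by (simp add: levy_process_def)
      have "H z = ennreal (C / D) * ennreal (mix z)" for z
        unfolding H_def using C D nonneg by (intro ennreal_mult) auto
      thus ?thesis by (simp only:) (rule nn_integral_cmult, measurable)
    qed
    also have "\<dots> \<le> ennreal (C / D) * ennreal (exp (\<eta> * t) * mix y)"
      by (intro mult_left_mono super t) simp
    also have "\<dots> = ennreal (exp (\<eta> * t)) * H y"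
      using C D nonneg by (simp add: H_def mult_ac flip: ennreal_mult)
    finally show "(\<integral>\<^sup>+w. H (y + X t w) \<partial>M) \<le> ennreal (exp (\<eta> * t)) * H y" .
  next
    fix y :: "real^'d"
    assume "y \<in> ball 0 (2 * r)"
    hence "F y = 1" using S by (intro F_1) simp
    hence "1 \<le> C / D * mix y" using lower[of y] D by (simp add: field_simps)
    thus "1 \<le> H y" by (simp add: H_def)
  qed (use \<eta> r in auto)
  show "\<exists>C19 R. r < R \<and> (\<forall>x. R \<le> norm x \<longrightarrow> exit_laplace M X (- cball 0 r) \<eta> x \<le> ennreal (C19 * \<nu> x))"
  \<comment> \<open>\<open>upper\<close> gives \<open>H \<le> C * F\<close>, and
    \<open>F \<le> a * \<nu>\<close> away from the origin, which yields the constant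
    \<open>C * a\<close>.\<close>
  proof (rule exI[of _ "C * a"], rule exI[of _ "r + 1"], intro conjI allI impI)
    fix x :: "real^'d"
    assume "r + 1 \<le> norm x"
    hence x: "x \<noteq> 0" using r by auto
    have "C / D * mix x \<le> C / D * (D * F x)" using upper C D by (intro mult_left_mono) auto
    also have "\<dots> = C * F x" using D by simp
    also have "\<dots> \<le> C * (a * \<nu> x)"
      using capped_bounds(3)[OF a0 x] C unfolding F_def by (intro mult_left_mono) auto
    finally have "H x \<le> ennreal (C * a * \<nu> x)" unfolding H_def by (intro ennreal_leI) (simp add: mult_ac)
    thus "exit_laplace M X (- cball 0 r) \<eta> x \<le> ennreal (C * a * \<nu> x)" using bound order_trans by blast
  qed simp
qed

end
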